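(* There are absolute constants such that for every fixed integer $r\ge1$ there are infinite classes $\mathcal{G}_1$ and $\mathcal{G}_2$ of graphs without isolated vertices, all of \textsc{lu-mim} width $\Theta(r)$, such that for each $G_1\in\mathcal{G}_1$, $obdd(\varphi(G_1))\le 2^{O(r)}$, while for each $G_2\in\mathcal{G}_2$ with $n=|V(G_2)|$, $obdd(\varphi(G_2))\ge n^{\Omega(r)}$.
   Context: $\varphi(G)$ is the monotone 2-CNF with variables $V(G)$ and a clause $(u\vee v)$ for each edge $\{u,v\}$. An OBDD is a directed acyclic graph with one source and two sinks labelled true and false, each non-sink node labelled by a variable with two outgoing edges labelled $x$ and $\neg x$; no variable repeats on a path and the variables appear along every path consistently with a fixed permutation; it represents the function true on a total assignment $S$ iff some source-to-true-sink path has all edge labels in $S$. $obdd(\varphi)$ is the minimum number of nodes of an OBDD representing $\varphi$. For $U\subseteq V(G)$, the upper subgraph $G^U$ is obtained from $G$ by deleting all edges with both ends outside $U$. An induced $(A,B)$-matching of a graph $H$ is a matching each of whose edges has one end in $A$ and one in $B$, such that the subgraph of $H$ induced by its endpoints has only the matching edges. For a permutation $\pi=(v_1,\dots,v_n)$ of $V(G)$ with $V_i=\{v_1,\dots,v_i\}$, let $r_i$ be the largest size of an induced $(V_i,V(G)\setminus V_i)$-matching of $G^{V_i}$ and $r(\pi)=\max_i r_i$; the \textsc{lu-mim} width $lu(G)$ is the minimum of $r(\pi)$ over all permutations.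
   Formalization: Since obdd(φ(G)) ≥ n+2 without isolated vertices, the bound 2^{O(r)} holds for only finitely many G up to isomorphism; it is proved for a class infinite only as labelled graphs, and as 2^{O(r)}·n for an additional class infinite up to isomorphism. *)

theory Defs
  imports Complex_Main "HOL-Library.Sublist" "HOL-Combinatorics.Multiset_Permutations"
begin

record 'v ugraph =
  verts :: "'v set"
  edges :: "'v set set"

definition simple_graph :: "'v ugraph \<Rightarrow> bool" where
  "simple_graph G \<longleftrightarrow> finite (verts G) \<and> (\<forall>e \<in> edges G. e \<subseteq> verts G \<and> card e = 2)"

definition no_isolated :: "'v ugraph \<Rightarrow> bool" where
  "no_isolated G \<longleftrightarrow> (\<forall>v \<in> verts G. \<exists>e \<in> edges G. v \<in> e)"

definition graph_iso :: "('v ugraph \<times> 'v ugraph) set" where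
  "graph_iso = {(G, H). \<exists>f. bij_betw f (verts G) (verts H) \<and> edges H = (`) f ` edges G}"

text \<open>
  \<open>infinite \<G>\<close> counts labelled graphs, so isomorphic copies count separately; here
  isomorphic graphs are identified.
\<close>
definition infinite_up_to_iso :: "'v ugraph set \<Rightarrow> bool" where
  "infinite_up_to_iso \<G> \<longleftrightarrow> infinite (\<G> // graph_iso)"


definition upper_subgraph :: "'v ugraph \<Rightarrow> 'v set \<Rightarrow> 'v ugraph" where
  "upper_subgraph G U = \<lparr>verts = verts G, edges = {e \<in> edges G. e \<inter> U \<noteq> {}}\<rparr>"

definition induced_matching :: "'v ugraph \<Rightarrow> 'v set \<Rightarrow> 'v set \<Rightarrow> 'v set set \<Rightarrow> bool" where
  "induced_matching H A B M \<longleftrightarrow>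
     M \<subseteq> edges H \<and>
     (\<forall>e \<in> M. \<forall>e' \<in> M. e \<noteq> e' \<longrightarrow> e \<inter> e' = {}) \<and>
     (\<forall>e \<in> M. \<exists>a \<in> A. \<exists>b \<in> B. e = {a, b}) \<and>
     {e \<in> edges H. e \<subseteq> \<Union> M} = M"

definition max_induced_matching :: "'v ugraph \<Rightarrow> 'v set \<Rightarrow> 'v set \<Rightarrow> nat" where
  "max_induced_matching H A B = Max (card ` {M. induced_matching H A B M})"

text \<open>The empty prefix contributes 0 and only keeps the maximum defined for the empty graph.\<close>
definition lu_width_of :: "'v ugraph \<Rightarrow> 'v list \<Rightarrow> nat" where
  "lu_width_of G \<pi> = Max ((\<lambda>i. let U = set (take i \<pi>) in
     max_induced_matching (upper_subgraph G U) U (verts G - U)) ` {0..length \<pi>})"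

definition lu :: "'v ugraph \<Rightarrow> nat" where
  "lu G = Min (lu_width_of G ` permutations_of_set (verts G))"


datatype 'x literal = Pos 'x | Neg 'x

record 'x cnf =
  vars :: "'x set"
  clauses :: "'x literal set set"

definition total_assignment :: "'x set \<Rightarrow> 'x literal set \<Rightarrow> bool" where
  "total_assignment X S \<longleftrightarrow>
     S \<subseteq> Pos ` X \<union> Neg ` X \<and> (\<forall>x \<in> X. Pos x \<in> S \<longleftrightarrow> Neg x \<notin> S)"

definition satisfies :: "'x literal set \<Rightarrow> 'x cnf \<Rightarrow> bool" where
  "satisfies S F \<longleftrightarrow> (\<forall>C \<in> clauses F. C \<inter> S \<noteq> {})"

definition graph_cnf :: "'v ugraph \<Rightarrow> 'v cnf" where
  "graph_cnf G = \<lparr>vars = verts G, clauses = (\<lambda>e. Pos ` e) ` edges G\<rparr>"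


text \<open>
  \<open>hi u\<close> and \<open>lo u\<close> are the heads of the two edges leaving a non-sink node \<open>u\<close>; they may
  coincide. The values of \<open>var\<close>, \<open>hi\<close>, \<open>lo\<close> outside the non-sink nodes are irrelevant.
\<close>
record ('n, 'x) bdd =
  nodes :: "'n set"
  true_sink :: 'n
  false_sink :: 'n
  var :: "'n \<Rightarrow> 'x"
  hi :: "'n \<Rightarrow> 'n"
  lo :: "'n \<Rightarrow> 'n"

definition inner :: "('n, 'x) bdd \<Rightarrow> 'n set" where
  "inner B = nodes B - {true_sink B, false_sink B}"

definition arcs :: "('n, 'x) bdd \<Rightarrow> ('n \<times> 'x literal \<times> 'n) set" where
  "arcs B = (\<lambda>u. (u, Pos (var B u), hi B u)) ` inner B \<union> (\<lambda>u. (u, Neg (var B u), lo B u)) ` inner B"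

fun bdd_path :: "('n, 'x) bdd \<Rightarrow> 'n \<Rightarrow> ('n \<times> 'x literal \<times> 'n) list \<Rightarrow> 'n \<Rightarrow> bool" where
  "bdd_path B u [] v \<longleftrightarrow> u = v \<and> u \<in> nodes B"
| "bdd_path B u ((s, l, t) # as) v \<longleftrightarrow> s = u \<and> (s, l, t) \<in> arcs B \<and> bdd_path B t as v"

definition is_source :: "('n, 'x) bdd \<Rightarrow> 'n \<Rightarrow> bool" where
  "is_source B u \<longleftrightarrow> u \<in> nodes B \<and> (\<nexists>s l. (s, l, u) \<in> arcs B)"

definition wf_bdd :: "('n, 'x) bdd \<Rightarrow> bool" where
  "wf_bdd B \<longleftrightarrow>
     finite (nodes B) \<and>
     true_sink B \<in> nodes B \<and> false_sink B \<in> nodes B \<and> true_sink B \<noteq> false_sink B \<and>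
     (\<forall>(s, l, t) \<in> arcs B. t \<in> nodes B) \<and>
     acyclic {(s, t). \<exists>l. (s, l, t) \<in> arcs B} \<and>
     (\<exists>!u. is_source B u)"

text \<open>
  A permutation lists each variable once, so being a subsequence of \<open>\<pi>\<close> says both that no
  variable repeats on the path and that the variables occur in the order \<open>\<pi>\<close>.
\<close>
definition is_obdd :: "'x set \<Rightarrow> ('n, 'x) bdd \<Rightarrow> bool" where
  "is_obdd X B \<longleftrightarrow> wf_bdd B \<and>
     (\<exists>\<pi> \<in> permutations_of_set X. \<forall>u as v. bdd_path B u as v \<longrightarrow>
        subseq (map (\<lambda>(s, l, t). var B s) as) \<pi>)"

definition accepts :: "('n, 'x) bdd \<Rightarrow> 'x literal set \<Rightarrow> bool" where
  "accepts B S \<longleftrightarrow> (\<exists>u as. is_source B u \<and> bdd_path B u as (true_sink B) \<and>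
     (\<forall>(s, l, t) \<in> set as. l \<in> S))"

definition represents :: "('n, 'x) bdd \<Rightarrow> 'x cnf \<Rightarrow> bool" where
  "represents B F \<longleftrightarrow> is_obdd (vars F) B \<and>
     (\<forall>S. total_assignment (vars F) S \<longrightarrow> (accepts B S \<longleftrightarrow> satisfies S F))"

text \<open>Every OBDD is finite, so restricting its nodes to natural numbers loses nothing.\<close>
definition obdd :: "'x cnf \<Rightarrow> nat" where
  "obdd F = (LEAST k. \<exists>B :: (nat, 'x) bdd. represents B F \<and> card (nodes B) = k)"

end

theory Submission
  imports Defs "HOL-Library.Nat_Bijection" "HOL-Library.FuncSet"
begin

text \<open>
  All three classes consist of blow-ups of an \<open>N \<times> (2r + 1)\<close> grid in which every cell is a clique
  whose vertices are the nonempty subsets of \<open>{..<d}\<close>, and vertices in adjacent cells are joined iff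
  the subsets meet in an odd number of elements.

  Colour a cell black once at least half of its vertices have been listed by a permutation. Just
  before the first row or column becomes black, some \<open>r\<close> pairs of adjacent cells, pairwise far apart,
  consist of a black and a white cell. Choosing one false vertex in each of these black cells yields
  different sets of forced vertices in the white cells: half of a clique tells any two subsets apart.
  Hence an OBDD has at least \<open>2 ^ ((d - 1) r)\<close> nodes, which is a power \<open>n ^ \<Omega>(r)\<close> for large \<open>d\<close>,
  and the lu-mim width is at least \<open>r\<close>. Listing the cells column by column, at most \<open>2r + 2\<close> cells
  have a neighbour beyond the prefix; being cliques, each contributes at most one edge to an induced
  matching. For \<open>d = 1\<close> the graph is the plain grid, and the same order gives an OBDD of size
  \<open>2 ^ O(r) \<cdot> n\<close>.
\<close>

section \<open>OBDDs of graph CNFs\<close>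

text \<open>Encodes a total assignment by the set \<open>P\<close> of its true variables. Only
  \<open>X \<inter> P\<close> matters, so a prefix part and a suffix part can simply be
  united.\<close>

definition assignment :: "'x set \<Rightarrow> 'x set \<Rightarrow> 'x literal set" where
  "assignment X P = Pos ` (X \<inter> P) \<union> Neg ` (X - P)"

definition vertex_cover :: "'v ugraph \<Rightarrow> 'v set \<Rightarrow> bool" where
  "vertex_cover G P \<longleftrightarrow> (\<forall>e \<in> edges G. e \<inter> P \<noteq> {})"

lemma Pos_in_assignment [simp]: "Pos x \<in> assignment X P \<longleftrightarrow> x \<in> X \<and> x \<in> P"
  by (auto simp: assignment_def)

lemma Neg_in_assignment [simp]: "Neg x \<in> assignment X P \<longleftrightarrow> x \<in> X \<and> x \<notin> P"
  by (auto simp: assignment_def)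

lemma total_assignment_assignment: "total_assignment X (assignment X P)"
  by (auto simp: total_assignment_def assignment_def)

lemma total_assignmentE:
  assumes "total_assignment X S"
  obtains P where "S = assignment X P"
proof
  show "S = assignment X {x. Pos x \<in> S}"
  proof (rule set_eqI)
    fix l show "l \<in> S \<longleftrightarrow> l \<in> assignment X {x. Pos x \<in> S}"
      using assms by (cases l) (auto simp: total_assignment_def)
  qed
qed

lemma satisfies_graph_cnf:
  assumes "simple_graph G"
  shows "satisfies (assignment (verts G) P) (graph_cnf G) \<longleftrightarrow> vertex_cover G P"
proof -
  have "Pos ` e \<inter> assignment (verts G) P = Pos ` (e \<inter> P)" if "e \<in> edges G" for e
    using assms that unfolding simple_graph_def by (fastforce simp: subset_eq)
  then show ?thesis by (auto simp: satisfies_def vertex_cover_def graph_cnf_def)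
qed

lemma represents_graph_cnf:
  assumes "simple_graph G"
  shows "represents B (graph_cnf G) \<longleftrightarrow> is_obdd (verts G) B \<and>
    (\<forall>P. accepts B (assignment (verts G) P) \<longleftrightarrow> vertex_cover G P)"
proof -
  have "vars (graph_cnf G) = verts G" by (simp add: graph_cnf_def)
  then show ?thesis
    unfolding represents_def
    by (metis satisfies_graph_cnf[OF assms] total_assignment_assignment total_assignmentE)
qed

section \<open>Paths and subfunctions of OBDDs\<close>

lemma bdd_path_start: "bdd_path B u as v \<Longrightarrow> u \<in> nodes B"
  by (cases as) (auto simp: arcs_def inner_def)

lemma bdd_path_append:
  "bdd_path B u (as @ bs) w \<longleftrightarrow> (\<exists>v. bdd_path B u as v \<and> bdd_path B v bs w)"
  by (induction B u as w rule: bdd_path.induct) (auto dest: bdd_path_start)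

lemma sink_path:
  assumes "bdd_path B t as v" "t = true_sink B \<or> t = false_sink B"
  shows "as = [] \<and> v = t"
  using assms by (cases as) (auto simp: arcs_def inner_def)

text \<open>The two edges leaving an inner node carry complementary literals, of which an assignment
  contains only one, and a path into a sink can neither stop before it nor go on. So both paths make
  the same turns.\<close>

lemma bdd_path_deterministic:
  assumes "bdd_path B u as t" "bdd_path B u as' t'"
    and "\<forall>(s, l, t) \<in> set as. l \<in> assignment X P" "\<forall>(s, l, t) \<in> set as'. l \<in> assignment X P"
    and "t = true_sink B \<or> t = false_sink B" "t' = true_sink B \<or> t' = false_sink B"
  shows "t = t'"
  using assms
proof (induction as arbitrary: u as')
  case Nil
  then show ?case using sink_path by force
next
  case (Cons a as)
  obtain l v where a: "a = (u, l, v)" "(u, l, v) \<in> arcs B" "bdd_path B v as t"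
    using Cons.prems(1) by (cases a) auto
  have "u \<in> inner B" using a by (auto simp: arcs_def)
  then obtain l' v' bs where b: "as' = (u, l', v') # bs" "(u, l', v') \<in> arcs B" "bdd_path B v' bs t'"
    using Cons.prems(2,6) by (cases as') (auto simp: inner_def)
  have "v = v'" using a b Cons.prems(3,4) by (auto simp: arcs_def)
  then show ?case using Cons.IH[of v bs] a b Cons.prems by auto
qed

lemma obdd_var_in:
  assumes "is_obdd X B" "u \<in> inner B"
  shows "var B u \<in> X"
proof -
  obtain \<pi> where \<pi>: "\<pi> \<in> permutations_of_set X"
    and sub: "\<And>u as v. bdd_path B u as v \<Longrightarrow> subseq (map (\<lambda>(s, l, t). var B s) as) \<pi>"
    using assms(1) by (auto simp: is_obdd_def)
  have "(u, Pos (var B u), hi B u) \<in> arcs B" using assms(2) by (auto simp: arcs_def)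
  moreover from this have "hi B u \<in> nodes B" using assms(1) by (auto simp: is_obdd_def wf_bdd_def)
  ultimately have "bdd_path B u [(u, Pos (var B u), hi B u)] (hi B u)" by simp
  from sub[OF this] have "var B u \<in> set \<pi>" by (simp add: subseq_singleton_left)
  then show ?thesis using \<pi> by (simp add: permutations_of_setD)
qed

text \<open>Well-founded induction along the reversed edges: the edge relation is finite and
  acyclic, and at every inner node the assignment selects an outgoing edge.\<close>

lemma obdd_path_exists:
  assumes obdd: "is_obdd X B" and "u \<in> nodes B"
  shows "\<exists>as t. bdd_path B u as t \<and> (t = true_sink B \<or> t = false_sink B) \<and>
    (\<forall>(s, l, t) \<in> set as. l \<in> assignment X P)"
proof -
  define r where "r = {(s, t). \<exists>l. (s, l, t) \<in> arcs B}"
  have w: "wf_bdd B" using obdd by (simp add: is_obdd_def)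
  then have target: "t \<in> nodes B" if "(s, l, t) \<in> arcs B" for s l t
    using that unfolding wf_bdd_def by blast
  have "s \<in> nodes B" if "(s, l, t) \<in> arcs B" for s l t
    using that by (auto simp: arcs_def inner_def)
  with target have "r \<subseteq> nodes B \<times> nodes B" unfolding r_def by blast
  then have "finite r" using w by (auto simp: wf_bdd_def intro: finite_subset)
  moreover have "acyclic r" using w by (simp add: wf_bdd_def r_def)
  ultimately have "wf (r\<inverse>)" by (rule finite_acyclic_wf_converse)
  then show ?thesis using assms(2)
  proof (induction u rule: wf_induct_rule)
    case (less u)
    show ?case
    proof (cases "u \<in> inner B")
      case False
      then show ?thesis using less.prems by (intro exI[of _ "[]"] exI[of _ u]) (auto simp: inner_def)
    next
      case True
      define l v where "l = (if var B u \<in> P then Pos (var B u) else Neg (var B u))"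
        and "v = (if var B u \<in> P then hi B u else lo B u)"
      have arc: "(u, l, v) \<in> arcs B" using True by (auto simp: arcs_def l_def v_def)
      have lab: "l \<in> assignment X P" using obdd_var_in[OF obdd True] by (auto simp: l_def)
      have "v \<in> nodes B" using arc by (rule target)
      moreover have "(v, u) \<in> r\<inverse>" using arc by (auto simp: r_def)
      ultimately obtain as t where "bdd_path B v as t" "t = true_sink B \<or> t = false_sink B"
        "\<forall>(s, l, t) \<in> set as. l \<in> assignment X P" using less.IH by blast
      then show ?thesis using arc lab
        by (intro exI[of _ "(u, l, v) # as"] exI[of _ t]) auto
    qed
  qed
qed

text \<open>
  Following an assignment until all variables of a prefix of the order have been read ends in a
  node that determines the subfunction of the remaining variables.
\<close>
lemma obdd_subfunctions:
  fixes B :: "('n, 'x) bdd"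
  assumes obdd: "is_obdd X B"
  obtains \<pi> where "\<pi> \<in> permutations_of_set X"
    and "\<And>i I f. \<lbrakk>\<And>s. s \<in> I \<Longrightarrow> f s \<subseteq> set (take i \<pi>);
          \<And>s s'. s \<in> I \<Longrightarrow> s' \<in> I \<Longrightarrow> s \<noteq> s' \<Longrightarrow> \<exists>Q \<subseteq> set (drop i \<pi>).
            accepts B (assignment X (f s \<union> Q)) \<noteq> accepts B (assignment X (f s' \<union> Q))\<rbrakk>
          \<Longrightarrow> card I \<le> card (nodes B)"
proof -
  define vs where "vs = map (\<lambda>(s, l :: 'x literal, t :: 'n). var B s)"
  obtain \<pi> where \<pi>: "\<pi> \<in> permutations_of_set X"
    and sub: "\<And>u as v. bdd_path B u as v \<Longrightarrow> subseq (vs as) \<pi>"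
    using obdd by (auto simp: is_obdd_def vs_def)
  obtain s0 where s0: "is_source B s0" and s0u: "\<And>u. is_source B u \<Longrightarrow> u = s0"
    using obdd unfolding is_obdd_def wf_bdd_def by blast
  have "s0 \<in> nodes B" using s0 by (simp add: is_source_def)
  have disj: "set (take i \<pi>) \<inter> set (drop i \<pi>) = {}" for i
    using \<pi> by (simp add: permutations_of_setD set_take_disj_set_drop_if_distinct)
  \<comment> \<open>The variables of a path form a subsequence of \<pi>, so those among the first
    \<open>i\<close> positions all precede the others.\<close>
  have split: "\<exists>xs ys. as = xs @ ys \<and> set (vs xs) \<subseteq> set (take i \<pi>) \<and> set (vs ys) \<subseteq> set (drop i \<pi>)"
    if "bdd_path B u as v" for u as v i
  proof -
    have "subseq (vs as) (take i \<pi> @ drop i \<pi>)" using sub[OF that] by simp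
    then obtain as1 as2 where eq: "vs as = as1 @ as2"
      and subs: "subseq as1 (take i \<pi>)" "subseq as2 (drop i \<pi>)"
      by (rule subseq_appendE)
    have "vs (take (length as1) as) = take (length as1) (vs as)"
      "vs (drop (length as1) as) = drop (length as1) (vs as)"
      by (simp_all only: vs_def take_map drop_map)
    then have "vs (take (length as1) as) = as1" "vs (drop (length as1) as) = as2"
      by (simp_all add: eq)
    moreover have "set as1 \<subseteq> set (take i \<pi>)" using list_emb_set[OF subs(1)] by blast
    moreover have "set as2 \<subseteq> set (drop i \<pi>)" using list_emb_set[OF subs(2)] by blast
    ultimately show ?thesis by (metis append_take_drop_id)
  qed
  \<comment> \<open>\<open>w\<close> is the node where reading \<open>P\<close> passes from the
    prefix to the suffix: the path to it tests prefix variables only, and its own variable, if any,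
    lies in the suffix.\<close>
  define cut where "cut i P w \<longleftrightarrow> w \<in> nodes B \<and> (\<exists>as. bdd_path B s0 as w \<and>
      (\<forall>(s, l, t) \<in> set as. l \<in> assignment X P) \<and> set (vs as) \<subseteq> set (take i \<pi>)) \<and>
      (w \<in> inner B \<longrightarrow> var B w \<in> set (drop i \<pi>))" for i P w
  have cut_ex: "\<exists>w. cut i P w" for i P
  proof -
    obtain as t where as: "bdd_path B s0 as t" "t = true_sink B \<or> t = false_sink B"
      "\<forall>(s, l, t) \<in> set as. l \<in> assignment X P"
      using obdd_path_exists[OF obdd \<open>s0 \<in> nodes B\<close>] by blast
    obtain xs ys where s: "as = xs @ ys" "set (vs xs) \<subseteq> set (take i \<pi>)" "set (vs ys) \<subseteq> set (drop i \<pi>)"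
      using split[OF as(1)] by blast
    obtain w where w: "bdd_path B s0 xs w" "bdd_path B w ys t"
      using as(1) s(1) by (auto simp: bdd_path_append)
    have "var B w \<in> set (drop i \<pi>)" if "w \<in> inner B"
    proof -
      have "ys \<noteq> []" using that w(2) as(2) by (auto simp: inner_def)
      then show ?thesis using w(2) s(3) by (cases ys) (auto simp: vs_def)
    qed
    then have "cut i P w"
      unfolding cut_def using w s as(3) bdd_path_start[OF w(2)]
      by (intro conjI exI[of _ xs]) auto
    then show ?thesis ..
  qed
  \<comment> \<open>Acceptance of \<open>P \<union> Q\<close> depends on \<open>P\<close> only
    through \<open>w\<close>, so distinguishable prefixes need different nodes.\<close>
  have key: "accepts B (assignment X (P \<union> Q)) \<longleftrightarrow> (\<exists>as. bdd_path B w as (true_sink B) \<and>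
      set (vs as) \<subseteq> set (drop i \<pi>) \<and> (\<forall>(s, l, t) \<in> set as. l \<in> assignment X Q))"
    if cut: "cut i P w" and P: "P \<subseteq> set (take i \<pi>)" and Q: "Q \<subseteq> set (drop i \<pi>)" for i P w Q
  proof -
    obtain xs where xs: "bdd_path B s0 xs w" "\<forall>(s, l, t) \<in> set xs. l \<in> assignment X P"
      "set (vs xs) \<subseteq> set (take i \<pi>)" using cut by (auto simp: cut_def)
    have arc_lab: "l = Pos (var B s) \<or> l = Neg (var B s)" if "(s, l, t) \<in> arcs B" for s l t
      using that by (auto simp: arcs_def)
    have path_arcs: "set as \<subseteq> arcs B" if "bdd_path B u as v" for u as v
      using that by (induction B u as v rule: bdd_path.induct) auto
    have xs': "\<forall>(s, l, t) \<in> set xs. l \<in> assignment X (P \<union> Q)"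
    proof safe
      fix s l t assume a: "(s, l, t) \<in> set xs"
      then have "var B s \<in> set (take i \<pi>)" using xs(3) by (force simp: vs_def)
      then have "var B s \<notin> Q" using disj Q by blast
      then show "l \<in> assignment X (P \<union> Q)"
        using arc_lab[of s l t] path_arcs[OF xs(1)] xs(2) a by fastforce
    qed
    have suffix: "l \<in> assignment X (P \<union> Q) \<longleftrightarrow> l \<in> assignment X Q"
      if a: "(s, l, t) \<in> set as" and "bdd_path B u as v" "set (vs as) \<subseteq> set (drop i \<pi>)" for as s l t u v
    proof -
      have "var B s \<in> set (drop i \<pi>)" using that by (force simp: vs_def)
      then have "var B s \<notin> P" using disj P by blast
      then show ?thesis using arc_lab[of s l t] path_arcs[OF that(2)] a by fastforce
    qed
    show ?thesis
    proof
      assume "accepts B (assignment X (P \<union> Q))"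
      then obtain bs where bs: "bdd_path B s0 bs (true_sink B)"
        "\<forall>(s, l, t) \<in> set bs. l \<in> assignment X (P \<union> Q)"
        using s0u by (auto simp: accepts_def)
      have "w \<in> nodes B" using cut by (simp add: cut_def)
      then obtain ys t where ys: "bdd_path B w ys t" "t = true_sink B \<or> t = false_sink B"
        "\<forall>(s, l, t) \<in> set ys. l \<in> assignment X (P \<union> Q)"
        using obdd_path_exists[OF obdd] by blast
      have full: "bdd_path B s0 (xs @ ys) t" using xs(1) ys(1) by (auto simp: bdd_path_append)
      moreover have "\<forall>(s, l, t) \<in> set (xs @ ys). l \<in> assignment X (P \<union> Q)" using xs' ys(3) by auto
      ultimately have t: "t = true_sink B"
        using bdd_path_deterministic[OF full bs(1) _ bs(2) ys(2)] by blast
      \<comment> \<open>Unless it is a sink, \<open>w\<close> tests a suffix variable; by the order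
        no later node on the path can test a prefix variable.\<close>
      have vsub: "set (vs ys) \<subseteq> set (drop i \<pi>)"
      proof (cases ys)
        case (Cons y ys')
        then have "w \<in> inner B" and vsys: "vs ys = var B w # vs ys'"
          using ys(1) by (cases y; auto simp: arcs_def vs_def)+
        then have vw: "var B w \<in> set (drop i \<pi>)" using cut by (auto simp: cut_def)
        obtain as1 as2 where sp: "xs @ ys = as1 @ as2" "set (vs as1) \<subseteq> set (take i \<pi>)"
          "set (vs as2) \<subseteq> set (drop i \<pi>)" using split[OF full] by blast
        have "var B w \<notin> set (vs as1)" using vw sp(2) disj by blast
        obtain zs where "xs = as1 @ zs \<and> zs @ ys = as2 \<or> xs @ zs = as1 \<and> ys = zs @ as2"
          using sp(1) by (auto simp: append_eq_append_conv2)
        then have "set ys \<subseteq> set as2"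
        proof
          \<comment> \<open>If the prefix part \<open>as1\<close> reached beyond \<open>xs\<close>,
            it would contain the variable of \<open>w\<close>, which lies in the suffix; so
            \<open>zs\<close> is empty.\<close>
          assume zs: "xs @ zs = as1 \<and> ys = zs @ as2"
          then have "vs ys = vs zs @ vs as2" "vs as1 = vs xs @ vs zs" by (auto simp: vs_def)
          with vsys \<open>var B w \<notin> set (vs as1)\<close> have "vs zs = []" by (cases "vs zs") auto
          then show ?thesis using zs by (simp add: vs_def)
        qed auto
        then have "set (vs ys) \<subseteq> set (vs as2)" unfolding vs_def set_map by (rule image_mono)
        then show ?thesis using sp(3) by (rule subset_trans)
      qed (simp add: vs_def)
      then show "\<exists>as. bdd_path B w as (true_sink B) \<and>
          set (vs as) \<subseteq> set (drop i \<pi>) \<and> (\<forall>(s, l, t) \<in> set as. l \<in> assignment X Q)"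
        using ys t suffix[OF _ ys(1)] by (intro exI[of _ ys]) auto
    next
      assume "\<exists>as. bdd_path B w as (true_sink B) \<and>
          set (vs as) \<subseteq> set (drop i \<pi>) \<and> (\<forall>(s, l, t) \<in> set as. l \<in> assignment X Q)"
      then obtain ys where ys: "bdd_path B w ys (true_sink B)" "set (vs ys) \<subseteq> set (drop i \<pi>)"
        "\<forall>(s, l, t) \<in> set ys. l \<in> assignment X Q" by blast
      have "\<forall>(s, l, t) \<in> set ys. l \<in> assignment X (P \<union> Q)"
        using suffix[OF _ ys(1,2)] ys(3) by blast
      then show "accepts B (assignment X (P \<union> Q))"
        unfolding accepts_def using s0 xs(1) xs' ys(1)
        by (intro exI[of _ s0] exI[of _ "xs @ ys"]) (auto simp: bdd_path_append)
    qed
  qed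
  show ?thesis
  proof
    show "\<pi> \<in> permutations_of_set X" by fact
    fix i I and f :: "'c \<Rightarrow> 'x set"
    assume pre: "\<And>s. s \<in> I \<Longrightarrow> f s \<subseteq> set (take i \<pi>)"
      and dist: "\<And>s s'. s \<in> I \<Longrightarrow> s' \<in> I \<Longrightarrow> s \<noteq> s' \<Longrightarrow> \<exists>Q \<subseteq> set (drop i \<pi>).
            accepts B (assignment X (f s \<union> Q)) \<noteq> accepts B (assignment X (f s' \<union> Q))"
    define w where "w s = (SOME w. cut i (f s) w)" for s
    have w: "cut i (f s) (w s)" for s unfolding w_def by (rule someI_ex) (rule cut_ex)
    have "inj_on w I"
    proof (rule inj_onI, rule ccontr)
      fix s s' assume s: "s \<in> I" "s' \<in> I" "w s = w s'" "s \<noteq> s'"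
      then obtain Q where Q: "Q \<subseteq> set (drop i \<pi>)"
        "accepts B (assignment X (f s \<union> Q)) \<noteq> accepts B (assignment X (f s' \<union> Q))"
        using dist by blast
      show False
        using key[OF w[of s] pre[OF s(1)] Q(1)] key[OF w[of s'] pre[OF s(2)] Q(1)] Q(2) s(3) by simp
    qed
    moreover have "w ` I \<subseteq> nodes B" using w by (auto simp: cut_def)
    moreover have "finite (nodes B)" using obdd by (simp add: is_obdd_def wf_bdd_def)
    ultimately show "card I \<le> card (nodes B)" by (rule card_inj_on_le)
  qed
qed

section \<open>OBDD size from the frontiers of a vertex order\<close>

definition frontier :: "'v ugraph \<Rightarrow> 'v set \<Rightarrow> 'v set" where
  "frontier G U = {u \<in> U. \<exists>w \<in> verts G - U. {u, w} \<in> edges G}"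

definition covers_within :: "'v ugraph \<Rightarrow> 'v set \<Rightarrow> 'v set \<Rightarrow> bool" where
  "covers_within G U P \<longleftrightarrow> (\<forall>e \<in> edges G. e \<subseteq> U \<longrightarrow> e \<inter> P \<noteq> {})"

text \<open>An edge that becomes internal when \<open>v\<close> is added joins \<open>v\<close> to a
  vertex of \<open>U\<close>, and \<open>v\<close> itself witnesses that this vertex is in the
  frontier. Hence the false frontier vertices are all that a prefix without an uncovered edge has to
  remember.\<close>

lemma covers_within_insert:
  assumes G: "simple_graph G" and "v \<notin> U" "v \<in> verts G"
  shows "covers_within G (insert v U) P \<longleftrightarrow> covers_within G U P \<and>
    (v \<in> P \<or> (\<forall>w \<in> frontier G U - P. {v, w} \<notin> edges G))"
proof (intro iffI conjI)
  assume c: "covers_within G (insert v U) P"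
  then show "covers_within G U P" by (auto simp: covers_within_def)
  show "v \<in> P \<or> (\<forall>w \<in> frontier G U - P. {v, w} \<notin> edges G)"
  proof (rule disjCI)
    assume *: "\<not> (\<forall>w \<in> frontier G U - P. {v, w} \<notin> edges G)"
    then obtain w where w: "w \<in> frontier G U" "w \<notin> P" "{v, w} \<in> edges G" by blast
    then have "{v, w} \<subseteq> insert v U" by (simp add: frontier_def)
    then have "{v, w} \<inter> P \<noteq> {}" using c w(3) unfolding covers_within_def by blast
    then show "v \<in> P" using w(2) by blast
  qed
next
  assume r: "covers_within G U P \<and> (v \<in> P \<or> (\<forall>w \<in> frontier G U - P. {v, w} \<notin> edges G))"
  show "covers_within G (insert v U) P" unfolding covers_within_def
  proof (intro ballI impI notI)
    fix e assume e: "e \<in> edges G" "e \<subseteq> insert v U" "e \<inter> P = {}"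
    have "v \<in> e"
    proof (rule ccontr)
      assume "v \<notin> e"
      then have "e \<subseteq> U" using e by blast
      then show False using r e by (simp add: covers_within_def)
    qed
    obtain x y where xy: "e = {x, y}" "x \<noteq> y" using G e(1) unfolding simple_graph_def
      by (metis card_2_iff)
    obtain w where w: "e = {v, w}" "w \<noteq> v" using \<open>v \<in> e\<close> xy by auto
    then have "w \<in> U" using e by auto
    moreover have "{w, v} \<in> edges G" using e(1) w by (simp add: insert_commute)
    ultimately have "w \<in> frontier G U - P" using assms(2,3) e(3) w by (auto simp: frontier_def)
    moreover have "v \<notin> P" using e(3) w by auto
    ultimately show False using r e(1) w by blast
  qed
qed

lemma covers_within_cong:
  assumes "P \<inter> U = Q \<inter> U"
  shows "covers_within G U P \<longleftrightarrow> covers_within G U Q"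
proof -
  have "e \<inter> P = e \<inter> Q" if "e \<subseteq> U" for e using assms that by blast
  then show ?thesis by (auto simp: covers_within_def)
qed

text \<open>A vertex that has left the frontier never returns, so the new state can be computed from
  the old one.\<close>

lemma frontier_insert_subset: "frontier G (insert v U) \<subseteq> insert v (frontier G U)"
  by (auto simp: frontier_def)

text \<open>
  The OBDD keeps track of the false vertices in the frontier of the prefix read so far;
  node 0 is the true sink and node 1 the false sink.
\<close>

definition code_node :: "nat \<Rightarrow> nat set \<Rightarrow> nat" where
  "code_node i T = Suc (Suc (prod_encode (i, set_encode T)))"

definition node_level :: "nat \<Rightarrow> nat" where
  "node_level u = fst (prod_decode (u - 2))"

definition node_state :: "nat \<Rightarrow> nat set" where
  "node_state u = set_decode (snd (prod_decode (u - 2)))"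

lemma node_level_code [simp]: "node_level (code_node i T) = i"
  by (simp add: node_level_def code_node_def)

lemma node_state_code [simp]: "finite T \<Longrightarrow> node_state (code_node i T) = T"
  by (simp add: node_state_def code_node_def)

lemma code_node_not_sink [simp]:
  "code_node i T \<noteq> 0" "code_node i T \<noteq> 1" "0 \<noteq> code_node i T" "code_node i T \<noteq> Suc 0"
  by (simp_all add: code_node_def)

text \<open>An edge makes the formula falsifiable, so both sinks are reached; an unreached sink
  would be a second source.\<close>

locale frontier_obdd =
  fixes G :: "nat ugraph" and \<pi> :: "nat list"
  assumes simple: "simple_graph G" and edges_nonempty: "edges G \<noteq> {}"
    and perm: "\<pi> \<in> permutations_of_set (verts G)"
begin

definition U :: "nat \<Rightarrow> nat set" where "U i = set (take i \<pi>)"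

text \<open>The node at which \<open>P\<close> arrives after \<open>i\<close> variables; an
  uncovered edge leads to the false sink at once. Taking exactly these nodes for \<open>B\<close>
  makes every node reachable.\<close>

definition target :: "nat \<Rightarrow> nat set \<Rightarrow> nat" where
  "target i P = (if \<not> covers_within G (U i) P then 1
     else if i = length \<pi> then 0 else code_node i (frontier G (U i) - P))"

text \<open>\<open>hi\<close> and \<open>lo\<close> have to be functions of the node, so the move is
  computed from the coded state rather than from \<open>P\<close>; \<open>succ_target\<close>
  relates the two.\<close>

definition succ :: "nat \<Rightarrow> bool \<Rightarrow> nat" where
  "succ u b = (let i = node_level u; v = \<pi> ! i in
     if \<not> b \<and> (\<exists>w \<in> node_state u. {v, w} \<in> edges G) then 1
     else if Suc i = length \<pi> then 0
     else code_node (Suc i) (frontier G (U (Suc i)) \<inter> (if b then node_state u else insert v (node_state u))))"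

definition B :: "(nat, nat) bdd" where
  "B = \<lparr>nodes = {target i P | i P. i \<le> length \<pi>}, true_sink = 0, false_sink = 1,
     var = (\<lambda>u. \<pi> ! node_level u), hi = (\<lambda>u. succ u True), lo = (\<lambda>u. succ u False)\<rparr>"

lemma distinct_perm: "distinct \<pi>" and set_perm: "set \<pi> = verts G"
  using perm by (simp_all add: permutations_of_setD)

lemma finite_U [simp]: "finite (U i)" "finite (frontier G (U i))"
  by (simp_all add: U_def frontier_def)

lemma U_Suc: "i < length \<pi> \<Longrightarrow> U (Suc i) = insert (\<pi> ! i) (U i)"
  by (simp add: U_def take_Suc_conv_app_nth)

lemma nth_notin_U: "i < length \<pi> \<Longrightarrow> \<pi> ! i \<notin> U i"
  using distinct_perm by (auto simp: U_def in_set_conv_nth nth_eq_iff_index_eq)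

lemma nth_in_verts: "i < length \<pi> \<Longrightarrow> \<pi> ! i \<in> verts G"
  using set_perm nth_mem by blast

lemma U_length: "U (length \<pi>) = verts G"
  by (simp add: U_def set_perm)

lemma edgeD: "e \<in> edges G \<Longrightarrow> e \<subseteq> verts G \<and> e \<noteq> {}"
  using simple by (fastforce simp: simple_graph_def)

lemma length_pos: "0 < length \<pi>"
proof -
  obtain e where "e \<in> edges G" using edges_nonempty by blast
  then have "verts G \<noteq> {}" using edgeD by blast
  then show ?thesis using set_perm by auto
qed

lemma covers_within_length: "covers_within G (U (length \<pi>)) P \<longleftrightarrow> vertex_cover G P"
  using edgeD by (auto simp: U_length covers_within_def vertex_cover_def)

lemma target_0 [simp]: "target 0 P = code_node 0 {}"
  using length_pos edgeD by (force simp: target_def U_def covers_within_def frontier_def)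

lemma target_length: "target (length \<pi>) P = (if vertex_cover G P then 0 else 1)"
  by (simp add: target_def covers_within_length)

lemma covers_within_mono: "covers_within G (U (Suc i)) P \<Longrightarrow> covers_within G (U i) P"
  using set_take_subset_set_take[of i "Suc i" \<pi>] unfolding U_def covers_within_def by fastforce

lemma target_cong: "P \<inter> U i = Q \<inter> U i \<Longrightarrow> target i P = target i Q"
proof -
  assume eq: "P \<inter> U i = Q \<inter> U i"
  then have "frontier G (U i) - P = frontier G (U i) - Q" unfolding frontier_def by blast
  with covers_within_cong[OF eq] show ?thesis by (simp add: target_def)
qed

lemma succ_target:
  assumes "i < length \<pi>" "covers_within G (U i) P"
  shows "succ (target i P) (\<pi> ! i \<in> P) = target (Suc i) P"
proof -
  have t: "target i P = code_node i (frontier G (U i) - P)" using assms by (simp add: target_def)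
  have fin: "finite (frontier G (U i) - P)" by simp
  have c: "covers_within G (U (Suc i)) P \<longleftrightarrow>
      \<pi> ! i \<in> P \<or> (\<forall>w \<in> frontier G (U i) - P. {\<pi> ! i, w} \<notin> edges G)"
    using covers_within_insert[OF simple nth_notin_U nth_in_verts] assms by (simp add: U_Suc)
  have f: "frontier G (U (Suc i)) \<inter> (if \<pi> ! i \<in> P then frontier G (U i) - P
      else insert (\<pi> ! i) (frontier G (U i) - P)) = frontier G (U (Suc i)) - P"
    using frontier_insert_subset[of G "\<pi> ! i" "U i"] nth_notin_U[OF assms(1)]
    by (auto simp: U_Suc[OF assms(1)])
  show ?thesis unfolding succ_def Let_def t node_level_code node_state_code[OF fin] f
    unfolding target_def c by auto
qed

lemma innerE:
  assumes "u \<in> inner B"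
  obtains i P where "i < length \<pi>" "covers_within G (U i) P" "u = target i P" "node_level u = i"
proof -
  obtain i P where "i \<le> length \<pi>" "u = target i P" "u \<noteq> 0" "u \<noteq> 1"
    using assms by (auto simp: inner_def B_def)
  moreover from this have "i < length \<pi>" "covers_within G (U i) P" "node_level u = i"
    by (auto simp: target_def split: if_splits)
  ultimately show ?thesis using that by blast
qed

lemma arc_iff: "(s, l, t) \<in> arcs B \<longleftrightarrow> s \<in> inner B \<and>
    (\<exists>i P. i < length \<pi> \<and> covers_within G (U i) P \<and> s = target i P \<and> t = target (Suc i) P \<and>
       node_level s = i \<and> l = (if \<pi> ! i \<in> P then Pos (\<pi> ! i) else Neg (\<pi> ! i)))"
    (is "_ \<longleftrightarrow> ?R s l t")
proof
  assume "(s, l, t) \<in> arcs B"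
  then have s: "s \<in> inner B" and
    lt: "l = Pos (\<pi> ! node_level s) \<and> t = succ s True \<or> l = Neg (\<pi> ! node_level s) \<and> t = succ s False"
    by (auto simp: arcs_def B_def)
  obtain i P where iP: "i < length \<pi>" "covers_within G (U i) P" "s = target i P" "node_level s = i"
    using s by (rule innerE)
  \<comment> \<open>A node may arise from many \<open>P\<close>. Changing \<open>P\<close> only at
    \<open>\<pi> ! i\<close>, which is outside \<open>U i\<close>, realises either label without
    changing the source node.\<close>
  define P' where "P' = (if l = Pos (\<pi> ! i) then insert (\<pi> ! i) P else P - {\<pi> ! i})"
  have eq: "P' \<inter> U i = P \<inter> U i" using nth_notin_U[OF iP(1)] by (auto simp: P'_def)
  then have c: "covers_within G (U i) P'" using iP(2) covers_within_cong by blast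
  have "s = target i P'" using target_cong[OF eq] iP(3) by simp
  moreover have "t = target (Suc i) P'"
    using succ_target[OF iP(1) c] lt iP(4) \<open>s = target i P'\<close> by (auto simp: P'_def)
  moreover have "l = (if \<pi> ! i \<in> P' then Pos (\<pi> ! i) else Neg (\<pi> ! i))"
    using lt iP(4) by (auto simp: P'_def)
  ultimately show "?R s l t" using s iP(1,4) c by blast
next
  assume r: "?R s l t"
  then obtain i P where iP: "i < length \<pi>" "covers_within G (U i) P" "s = target i P" "t = target (Suc i) P"
     "node_level s = i" "l = (if \<pi> ! i \<in> P then Pos (\<pi> ! i) else Neg (\<pi> ! i))" by blast
  have "t = succ s (\<pi> ! i \<in> P)" using succ_target[OF iP(1,2)] iP by simp
  moreover have "s \<in> inner B" using r by blast
  moreover have "var B s = \<pi> ! i" "hi B s = succ s True" "lo B s = succ s False"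
    using iP(5) by (simp_all add: B_def)
  ultimately show "(s, l, t) \<in> arcs B" using iP(6) unfolding arcs_def
    by (cases "\<pi> ! i \<in> P") (auto intro: rev_image_eqI)
qed

lemma target_in_nodes: "i \<le> length \<pi> \<Longrightarrow> target i P \<in> nodes B"
  by (auto simp: B_def)

lemma target_inner:
  assumes "i < length \<pi>" "covers_within G (U i) P"
  shows "target i P \<in> inner B"
  using assms target_in_nodes[of i P] by (auto simp: inner_def target_def B_def)

lemma step_arc:
  assumes "i < length \<pi>" "covers_within G (U i) P"
  shows "(target i P, if \<pi> ! i \<in> P then Pos (\<pi> ! i) else Neg (\<pi> ! i), target (Suc i) P) \<in> arcs B"
proof -
  have "node_level (target i P) = i" using assms by (simp add: target_def)
  then show ?thesis using target_inner[OF assms] assms unfolding arc_iff by blast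
qed

text \<open>Both sinks get the level \<open>length \<pi>\<close>, so that levels rise along every
  arc, including one that drops early to the false sink. This gives acyclicity and the variable
  order.\<close>

definition lv :: "nat \<Rightarrow> nat" where
  "lv u = (if u = 0 \<or> u = 1 then length \<pi> else node_level u)"

lemma arc_level: "(s, l, t) \<in> arcs B \<Longrightarrow> Suc (lv s) \<le> lv t \<and> lv s = node_level s \<and> lv s < length \<pi>"
  unfolding arc_iff by (auto simp: lv_def target_def inner_def B_def)

text \<open>Apart from the sinks, a node is a level below \<open>length \<pi>\<close> together with
  a subset of the frontier at that level.\<close>

lemma finite_nodes: "finite (nodes B)"
  and card_nodes_le: "(\<And>i. card (frontier G (U i)) \<le> k) \<Longrightarrow> card (nodes B) \<le> 2 + length \<pi> * 2 ^ k"
proof -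
  define N where "N = (\<lambda>(i, T). code_node i T) ` (SIGMA i:{..<length \<pi>}. Pow (frontier G (U i)))"
  have sub: "nodes B \<subseteq> {0, 1} \<union> N"
    by (force simp: B_def target_def N_def)
  have finN: "finite N" by (auto simp: N_def)
  show "finite (nodes B)" by (rule finite_subset[OF sub]) (use finN in auto)
  assume k: "\<And>i. card (frontier G (U i)) \<le> k"
  have "card (nodes B) \<le> card ({0, 1} \<union> N)" by (rule card_mono[OF _ sub]) (use finN in auto)
  also have "\<dots> \<le> card {0, 1 :: nat} + card N" by (rule card_Un_le)
  also have "card N \<le> card (SIGMA i:{..<length \<pi>}. Pow (frontier G (U i)))"
    unfolding N_def by (rule card_image_le) auto
  also have "\<dots> = (\<Sum>i<length \<pi>. 2 ^ card (frontier G (U i)))"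
    by (simp add: card_Pow)
  also have "\<dots> \<le> (\<Sum>i<length \<pi>. 2 ^ k)"
    by (rule sum_mono) (simp add: k power_increasing)
  finally show "card (nodes B) \<le> 2 + length \<pi> * 2 ^ k" by simp
qed

text \<open>\<open>target (Suc i) P\<close> is entered from \<open>target i P\<close> unless
  \<open>P\<close> has already failed; then both are the false sink and the induction goes down a
  level.\<close>

lemma source_iff: "is_source B u \<longleftrightarrow> u = target 0 {}"
proof
  assume src: "is_source B u"
  then obtain i P where i: "i \<le> length \<pi>" "u = target i P" by (auto simp: is_source_def B_def)
  from i src show "u = target 0 {}"
  proof (induction i)
    case (Suc i)
    show ?case
    proof (cases "covers_within G (U i) P")
      case True
      then show ?thesis using step_arc[of i P] Suc.prems by (auto simp: is_source_def)
    next
      case False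
      then have "target i P = 1" "target (Suc i) P = 1"
        using covers_within_mono by (auto simp: target_def)
      then show ?thesis using Suc by simp
    qed
  qed simp
next
  have "(s, l, target 0 {}) \<notin> arcs B" for s l
    using arc_level[of s l "target 0 {}"] by (auto simp: lv_def)
  then show "u = target 0 {} \<Longrightarrow> is_source B u"
    using target_in_nodes[of 0] by (auto simp: is_source_def)
qed

lemma wf_bdd_B: "wf_bdd B"
proof -
  define r where "r = {(s, t). \<exists>l. (s, l, t) \<in> arcs B}"
  have less: "(s, t) \<in> r \<Longrightarrow> lv s < lv t" for s t using arc_level by (fastforce simp: r_def)
  have "lv s < lv t" if "(s, t) \<in> r\<^sup>+" for s t
    using that by induction (use less less_trans in blast)+
  then have "acyclic r" by (fastforce simp: acyclic_def)
  moreover have "0 \<in> nodes B" "1 \<in> nodes B"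
  proof -
    have "vertex_cover G (verts G)" "\<not> vertex_cover G {}"
      using edgeD edges_nonempty by (auto simp: vertex_cover_def Int_absorb2)
    then show "0 \<in> nodes B" "1 \<in> nodes B"
      using target_in_nodes[of "length \<pi>" "verts G"] target_in_nodes[of "length \<pi>" "{}"]
      by (simp_all add: target_length)
  qed
  moreover have "\<forall>(s, l, t) \<in> arcs B. t \<in> nodes B"
    using target_in_nodes by (fastforce simp: arc_iff)
  moreover have "true_sink B = 0" "false_sink B = 1" by (simp_all add: B_def)
  moreover have "\<exists>!u. is_source B u" by (simp add: source_iff)
  ultimately show ?thesis using finite_nodes by (simp add: wf_bdd_def r_def)
qed

lemma path_subseq: "bdd_path B u as v \<Longrightarrow> subseq (map (\<lambda>a. var B (fst a)) as) (drop (lv u) \<pi>)"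
proof (induction as arbitrary: u)
  case (Cons a as)
  obtain l t where a: "a = (u, l, t)" "(u, l, t) \<in> arcs B" "bdd_path B t as v"
    using Cons.prems by (cases a) auto
  note lv = arc_level[OF a(2)]
  have "drop (lv t) \<pi> = drop (lv t - Suc (lv u)) (drop (Suc (lv u)) \<pi>)" using lv by simp
  then have "subseq (drop (lv t) \<pi>) (drop (Suc (lv u)) \<pi>)"
    by (metis append_take_drop_id subseq_drop_many subseq_order.order_refl)
  then have "subseq (map (\<lambda>a. var B (fst a)) as) (drop (Suc (lv u)) \<pi>)"
    using Cons.IH[OF a(3)] subseq_order.order_trans by blast
  moreover have "var B u = \<pi> ! lv u" using lv by (simp add: B_def)
  moreover have "drop (lv u) \<pi> = \<pi> ! lv u # drop (Suc (lv u)) \<pi>"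
    using lv by (simp add: Cons_nth_drop_Suc)
  ultimately show ?case using a(1) by simp
qed simp

lemma is_obdd_B: "is_obdd (verts G) B"
proof -
  have "subseq (drop i \<pi>) \<pi>" for i by (metis append_take_drop_id subseq_drop_many subseq_order.order_refl)
  then have "subseq (map (\<lambda>a. var B (fst a)) as) \<pi>" if "bdd_path B u as v" for u as v
    using path_subseq[OF that] subseq_order.order_trans by blast
  moreover have "(\<lambda>(s, l :: nat literal, t :: nat). var B s) = (\<lambda>a. var B (fst a))"
    by (simp add: fun_eq_iff)
  ultimately show ?thesis unfolding is_obdd_def using wf_bdd_B perm by auto
qed

lemma assignment_path:
  assumes "i \<le> length \<pi>"
  shows "\<exists>as. bdd_path B (target 0 {}) as (target i P) \<and> (\<forall>(s, l, t) \<in> set as. l \<in> assignment (verts G) P)"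
  using assms
proof (induction i)
  case 0
  then show ?case using target_in_nodes[of 0] by (intro exI[of _ "[]"]) simp
next
  case (Suc i)
  then obtain as where as: "bdd_path B (target 0 {}) as (target i P)"
    "\<forall>(s, l, t) \<in> set as. l \<in> assignment (verts G) P" by auto
  show ?case
  proof (cases "covers_within G (U i) P")
    case True
    define a where "a = (target i P, if \<pi> ! i \<in> P then Pos (\<pi> ! i) else Neg (\<pi> ! i), target (Suc i) P)"
    have "a \<in> arcs B" using step_arc True Suc.prems by (simp add: a_def)
    then have "bdd_path B (target i P) [a] (target (Suc i) P)"
      using target_in_nodes[of "Suc i" P] Suc.prems by (simp add: a_def)
    moreover have "fst (snd a) \<in> assignment (verts G) P"
      using nth_in_verts Suc.prems by (simp add: a_def)
    ultimately show ?thesis using as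
      by (intro exI[of _ "as @ [a]"]) (auto simp: bdd_path_append split_beta)
  next
    case False
    then have "target i P = 1" "target (Suc i) P = 1"
      using covers_within_mono by (auto simp: target_def)
    then show ?thesis using as by (intro exI[of _ as]) simp
  qed
qed

lemma accepts_B: "accepts B (assignment (verts G) P) \<longleftrightarrow> vertex_cover G P"
proof -
  obtain as where as: "bdd_path B (target 0 {}) as (target (length \<pi>) P)"
    "\<forall>(s, l, t) \<in> set as. l \<in> assignment (verts G) P" using assignment_path by blast
  have sinks: "true_sink B = 0" "false_sink B = 1" by (simp_all add: B_def)
  show ?thesis
  proof
    assume "accepts B (assignment (verts G) P)"
    then obtain bs where "bdd_path B (target 0 {}) bs (true_sink B)"
      "\<forall>(s, l, t) \<in> set bs. l \<in> assignment (verts G) P" by (auto simp: accepts_def source_iff)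
    from bdd_path_deterministic[OF this(1) as(1) this(2) as(2)]
    have "target (length \<pi>) P = 0" by (simp add: sinks target_length)
    then show "vertex_cover G P" by (simp add: target_length split: if_splits)
  next
    assume "vertex_cover G P"
    then show "accepts B (assignment (verts G) P)"
      unfolding accepts_def using as by (auto simp: sinks target_length source_iff)
  qed
qed

lemma represents_B: "represents B (graph_cnf G)"
  using represents_graph_cnf[OF simple] is_obdd_B accepts_B by blast

end

lemma obdd_graph_cnf_le:
  fixes G :: "nat ugraph"
  assumes "simple_graph G" "edges G \<noteq> {}" "\<pi> \<in> permutations_of_set (verts G)"
    and "\<And>i. card (frontier G (set (take i \<pi>))) \<le> k"
  shows "obdd (graph_cnf G) \<le> 2 + card (verts G) * 2 ^ k"
proof -
  interpret frontier_obdd G \<pi> using assms by unfold_locales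
  have "obdd (graph_cnf G) \<le> card (nodes B)"
    unfolding obdd_def using represents_B by (intro Least_le) blast
  also have "\<dots> \<le> 2 + length \<pi> * 2 ^ k" using assms(4) by (intro card_nodes_le) (simp add: U_def)
  finally show ?thesis using set_perm distinct_perm distinct_card by metis
qed

text \<open>The \<open>LEAST\<close> in \<open>obdd\<close> is meaningful only when some OBDD
  exists. The construction provides one, so that bounds valid for every OBDD pass to the
  minimum.\<close>

lemma obdd_attained:
  fixes G :: "nat ugraph"
  assumes "simple_graph G" "edges G \<noteq> {}"
  shows "\<exists>B :: (nat, nat) bdd. represents B (graph_cnf G) \<and> card (nodes B) = obdd (graph_cnf G)"
proof -
  have "finite (verts G)" using assms(1) by (simp add: simple_graph_def)
  then obtain \<pi> where "\<pi> \<in> permutations_of_set (verts G)"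
    by (metis finite_distinct_list permutations_of_setI)
  then interpret frontier_obdd G \<pi> using assms by unfold_locales
  have "\<exists>B :: (nat, nat) bdd. represents B (graph_cnf G) \<and> card (nodes B) = card (nodes local.B)"
    using represents_B by blast
  then show ?thesis unfolding obdd_def by (rule LeastI)
qed

section \<open>Grids of cliques\<close>

definition grid_adjacent :: "nat \<times> nat \<Rightarrow> nat \<times> nat \<Rightarrow> bool" where
  "grid_adjacent g h \<longleftrightarrow>
     fst g = fst h \<and> (snd h = Suc (snd g) \<or> snd g = Suc (snd h)) \<or>
     snd g = snd h \<and> (fst h = Suc (fst g) \<or> fst g = Suc (fst h))"

lemma grid_adjacent_sym: "grid_adjacent g h \<longleftrightarrow> grid_adjacent h g"
  by (auto simp: grid_adjacent_def)

lemma grid_adjacent_irrefl [simp]: "\<not> grid_adjacent g g"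
  by (auto simp: grid_adjacent_def)

lemma grid_adjacent_swap: "grid_adjacent (prod.swap g) (prod.swap h) \<longleftrightarrow> grid_adjacent g h"
  by (auto simp: grid_adjacent_def)

text \<open>First components will be cells with a chosen listed vertex, second components cells with
  a chosen unlisted one. Two second cells may be adjacent: edges between unlisted vertices are
  absent from the upper subgraph, and the OBDD bound makes just one unlisted vertex false at a
  time.\<close>

definition separated :: "((nat \<times> nat) \<times> (nat \<times> nat)) set \<Rightarrow> bool" where
  "separated P \<longleftrightarrow> (\<forall>p \<in> P. \<forall>p' \<in> P. p \<noteq> p' \<longrightarrow>
     fst p \<noteq> fst p' \<and> \<not> grid_adjacent (fst p) (fst p') \<and>
     fst p \<noteq> snd p' \<and> \<not> grid_adjacent (fst p) (snd p') \<and> snd p \<noteq> snd p')"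

lemma separatedD:
  assumes "separated P" "p \<in> P" "p' \<in> P" "p \<noteq> p'"
  shows "fst p \<noteq> fst p'" "\<not> grid_adjacent (fst p) (fst p')" "fst p \<noteq> snd p'"
    "\<not> grid_adjacent (fst p) (snd p')" "snd p \<noteq> snd p'"
  using assms unfolding separated_def by blast+

lemma separated_swap:
  assumes "separated P"
  shows "separated (map_prod prod.swap prod.swap ` P)"
  unfolding separated_def
proof (intro ballI impI)
  fix x x' assume "x \<in> map_prod prod.swap prod.swap ` P" "x' \<in> map_prod prod.swap prod.swap ` P"
    and ne: "x \<noteq> x'"
  then obtain p p' where p: "p \<in> P" "p' \<in> P" "x = map_prod prod.swap prod.swap p"
    "x' = map_prod prod.swap prod.swap p'" by (elim imageE)
  have "p \<noteq> p'" using ne p(3,4) by blast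
  have swap_eq: "prod.swap a = prod.swap b \<longleftrightarrow> a = b" for a b :: "nat \<times> nat"
    by (cases a; cases b) auto
  show "fst x \<noteq> fst x' \<and> \<not> grid_adjacent (fst x) (fst x') \<and>
     fst x \<noteq> snd x' \<and> \<not> grid_adjacent (fst x) (snd x') \<and> snd x \<noteq> snd x'"
    using separatedD[OF assms p(1,2) \<open>p \<noteq> p'\<close>]
    by (simp add: p(3,4) grid_adjacent_swap swap_eq del: swap_simp)
qed

text \<open>Otherwise neighbouring positions would agree and \<open>f\<close> would be
  constant.\<close>

lemma line_crossing:
  fixes f :: "nat \<Rightarrow> bool"
  assumes "f x" "\<not> f y" "x < n" "y < n"
  shows "\<exists>z w. z < n \<and> w < n \<and> f z \<and> \<not> f w \<and> (w = Suc z \<or> z = Suc w)"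
proof (rule ccontr)
  assume no: "\<not> ?thesis"
  have eq: "f i = f (Suc i)" if "Suc i < n" for i
    using no that by (metis Suc_lessD)
  have "f i = f 0" if "i < n" for i
    using that by (induction i) (use eq Suc_lessD in blast)+
  then show False using assms by blast
qed

text \<open>Lines at even positions keep the crossings in different lines apart.\<close>
lemma column_crossings:
  assumes "2 * k < n" "\<rho> < m"
    and row: "\<And>c. c < n \<Longrightarrow> c \<noteq> c0 \<Longrightarrow> (c, \<rho>) \<in> S"
    and col: "\<And>c. c < n \<Longrightarrow> \<exists>r<m. (c, r) \<notin> S"
  shows "\<exists>P. finite P \<and> k \<le> card P \<and> separated P \<and>
    (\<forall>(g, h) \<in> P. grid_adjacent g h \<and> g \<in> {..<n} \<times> {..<m} \<and> h \<in> {..<n} \<times> {..<m} \<and> g \<in> S \<and> h \<notin> S)"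
proof -
  \<comment> \<open>Of the \<open>k + 1\<close> even columns at most one is the exceptional
    \<open>c0\<close>, which leaves at least \<open>k\<close>.\<close>
  define C where "C = (*) 2 ` {..k} - {c0}"
  have "k \<le> card C"
  proof -
    have "card ((*) 2 ` {..k}) = Suc k" by (subst card_image) (auto simp: inj_on_def)
    then show ?thesis unfolding C_def by (metis card_Diff1_le card_Diff_singleton_if diff_Suc_1 le_SucI order_refl)
  qed
  have C: "c < n" "c \<noteq> c0" "even c" if "c \<in> C" for c using that assms(1) by (auto simp: C_def)
  have "\<forall>c \<in> C. \<exists>z w. z < m \<and> w < m \<and> (c, z) \<in> S \<and> (c, w) \<notin> S \<and> (w = Suc z \<or> z = Suc w)"
  proof
    fix c assume "c \<in> C"
    then obtain r where "r < m" "(c, r) \<notin> S" "(c, \<rho>) \<in> S" using C row col by blast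
    then show "\<exists>z w. z < m \<and> w < m \<and> (c, z) \<in> S \<and> (c, w) \<notin> S \<and> (w = Suc z \<or> z = Suc w)"
      using line_crossing[of "\<lambda>r. (c, r) \<in> S" \<rho> r m] assms(2) by blast
  qed
  then obtain z w where zw: "\<And>c. c \<in> C \<Longrightarrow> z c < m \<and> w c < m \<and> (c, z c) \<in> S \<and> (c, w c) \<notin> S \<and>
      (w c = Suc (z c) \<or> z c = Suc (w c))" by metis
  define P where "P = (\<lambda>c. ((c, z c), (c, w c))) ` C"
  have "card P = card C" unfolding P_def by (rule card_image) (auto simp: inj_on_def)
  moreover have "finite P" by (simp add: P_def C_def)
  moreover have "separated P"
  proof -
    have far: "c \<noteq> c' \<and> c' \<noteq> Suc c \<and> c \<noteq> Suc c'" if "c \<in> C" "c' \<in> C" "c \<noteq> c'" for c c'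
      using C(3)[OF that(1)] C(3)[OF that(2)] that(3) by auto
    show ?thesis unfolding separated_def P_def
    proof (intro ballI impI)
      fix p p' assume "p \<in> (\<lambda>c. ((c, z c), (c, w c))) ` C" "p' \<in> (\<lambda>c. ((c, z c), (c, w c))) ` C" "p \<noteq> p'"
      then obtain c c' where c: "c \<in> C" "c' \<in> C" "c \<noteq> c'"
        "p = ((c, z c), (c, w c))" "p' = ((c', z c'), (c', w c'))" by blast
      show "fst p \<noteq> fst p' \<and> \<not> grid_adjacent (fst p) (fst p') \<and>
        fst p \<noteq> snd p' \<and> \<not> grid_adjacent (fst p) (snd p') \<and> snd p \<noteq> snd p'"
        using far[OF c(1-3)] c(4,5) by (simp add: grid_adjacent_def)
    qed
  qed
  moreover have "\<forall>(g, h) \<in> P. grid_adjacent g h \<and> g \<in> {..<n} \<times> {..<m} \<and> h \<in> {..<n} \<times> {..<m} \<and> g \<in> S \<and> h \<notin> S"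
    using zw C by (auto simp: P_def grid_adjacent_def)
  ultimately show ?thesis using \<open>k \<le> card C\<close> by (intro exI[of _ P]) simp
qed

text \<open>
  When a row or a column is filled for the first time, the lines perpendicular to it were still
  incomplete one step earlier but, with one exception, already contained a cell of it.
\<close>
lemma filling_crossings:
  fixes S :: "nat \<Rightarrow> (nat \<times> nat) set"
  assumes "2 * k < n" "2 * k < m" and "S 0 = {}" "{..<n} \<times> {..<m} \<subseteq> S L"
    and step: "\<And>i. i < L \<Longrightarrow> \<exists>x. S (Suc i) \<subseteq> insert x (S i)"
  shows "\<exists>j \<le> L. \<exists>P. finite P \<and> k \<le> card P \<and> separated P \<and>
    (\<forall>(g, h) \<in> P. grid_adjacent g h \<and> g \<in> {..<n} \<times> {..<m} \<and> h \<in> {..<n} \<times> {..<m} \<and> g \<in> S j \<and> h \<notin> S j)"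
proof -
  define full where "full T \<longleftrightarrow> (\<exists>c<n. \<forall>r<m. (c, r) \<in> T) \<or> (\<exists>r<m. \<forall>c<n. (c, r) \<in> T)"
    for T :: "(nat \<times> nat) set"
  \<comment> \<open>The first time some line is full; one step earlier every line still has a
    missing cell.\<close>
  define i where "i = (LEAST i. full (S i))"
  have "full (S L)" using assms(1,4) by (fastforce simp: full_def)
  then have i: "full (S i)" "i \<le> L" unfolding i_def by (auto intro: LeastI Least_le)
  have "\<not> full (S 0)" using assms(1-3) by (auto simp: full_def)
  then obtain j where j: "i = Suc j" using i(1) by (cases i) auto
  have nf: "\<not> full (S j)" using j not_less_Least[of j "\<lambda>i. full (S i)"] by (simp add: i_def)
  \<comment> \<open>At most the cell \<open>(c0, r0)\<close> is new, so the rest of the newly full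
    line is already in \<open>S j\<close>. The line through that cell perpendicular to the full one
    is the exception.\<close>
  obtain c0 r0 where x: "S i \<subseteq> insert (c0, r0) (S j)" using step[of j] i(2) j by auto
  have "\<exists>P. finite P \<and> k \<le> card P \<and> separated P \<and>
    (\<forall>(g, h) \<in> P. grid_adjacent g h \<and> g \<in> {..<n} \<times> {..<m} \<and> h \<in> {..<n} \<times> {..<m} \<and> g \<in> S j \<and> h \<notin> S j)"
  proof (cases "\<exists>r<m. \<forall>c<n. (c, r) \<in> S i")
    case True
    then obtain \<rho> where "\<rho> < m" "\<forall>c<n. (c, \<rho>) \<in> S i" by blast
    then show ?thesis using x nf assms(1)
      by (intro column_crossings[of k n \<rho> m c0]) (auto simp: full_def)
  next
    case False
    then obtain \<gamma> where g: "\<gamma> < n" "\<forall>r<m. (\<gamma>, r) \<in> S i" using i(1) by (auto simp: full_def)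
    \<comment> \<open>Transposing the grid turns the full column into a full row.\<close>
    have swap: "(a, b) \<in> prod.swap ` S j \<longleftrightarrow> (b, a) \<in> S j" for a b by force
    have "\<exists>P. finite P \<and> k \<le> card P \<and> separated P \<and>
      (\<forall>(g, h) \<in> P. grid_adjacent g h \<and> g \<in> {..<m} \<times> {..<n} \<and> h \<in> {..<m} \<times> {..<n} \<and>
         g \<in> prod.swap ` S j \<and> h \<notin> prod.swap ` S j)"
      using x nf assms(2) g
      by (intro column_crossings[of k m \<gamma> n r0]) (auto simp: full_def swap)
    then obtain P where P: "finite P" "k \<le> card P" "separated P"
      "\<forall>(g, h) \<in> P. grid_adjacent g h \<and> g \<in> {..<m} \<times> {..<n} \<and> h \<in> {..<m} \<times> {..<n} \<and>
         g \<in> prod.swap ` S j \<and> h \<notin> prod.swap ` S j" by (elim exE conjE)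
    have "card (map_prod prod.swap prod.swap ` P) = card P"
      by (rule card_image) (auto simp: inj_on_def map_prod_def)
    moreover have "\<forall>(g, h) \<in> map_prod prod.swap prod.swap ` P. grid_adjacent g h \<and>
        g \<in> {..<n} \<times> {..<m} \<and> h \<in> {..<n} \<times> {..<m} \<and> g \<in> S j \<and> h \<notin> S j"
    proof
      fix p' assume "p' \<in> map_prod prod.swap prod.swap ` P"
      then obtain p where p: "p \<in> P" "p' = map_prod prod.swap prod.swap p" by (elim imageE)
      obtain a b c d where abcd: "p = ((a, b), (c, d))" by (metis prod.exhaust)
      have "grid_adjacent (b, a) (d, c) \<longleftrightarrow> grid_adjacent (a, b) (c, d)"
        using grid_adjacent_swap[of "(a, b)" "(c, d)"] by simp
      then show "case p' of (g, h) \<Rightarrow> grid_adjacent g h \<and>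
        g \<in> {..<n} \<times> {..<m} \<and> h \<in> {..<n} \<times> {..<m} \<and> g \<in> S j \<and> h \<notin> S j"
        using bspec[OF P(4) p(1)] by (simp add: p(2) abcd swap)
    qed
    ultimately show ?thesis using P(1,2) separated_swap[OF P(3)]
      by (intro exI[of _ "map_prod prod.swap prod.swap ` P"]) simp
  qed
  then show ?thesis using i(2) j by (intro exI[of _ j]) simp
qed

section \<open>Parity of intersections\<close>

text \<open>The empty set meets every set in an even number of elements. Leaving it out gives every
  vertex a neighbour in each adjacent cell, and for \<open>d = 1\<close> it leaves one vertex per
  cell.\<close>

abbreviation nonempty_subsets :: "nat \<Rightarrow> nat set set" where
  "nonempty_subsets d \<equiv> Pow {..<d} - {{}}"

lemma card_nonempty_subsets: "card (nonempty_subsets d) = 2 ^ d - 1"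
  by (subst card_Diff_singleton) (auto simp: card_Pow)

text \<open>
  Toggling an element of the symmetric difference of \<open>A\<close> and \<open>B\<close> in \<open>C\<close> shows that exactly
  half of all sets \<open>C\<close> tell \<open>A\<close> and \<open>B\<close> apart.
\<close>
lemma parity_distinguishes:
  assumes AB: "A \<subseteq> {..<d}" "B \<subseteq> {..<d}" "A \<noteq> B" and d: "0 < d"
    and Y: "Y \<subseteq> nonempty_subsets d" "2 ^ (d - 1) \<le> card Y"
  shows "\<exists>C \<in> Y. odd (card (A \<inter> C)) \<noteq> odd (card (B \<inter> C))"
proof (rule ccontr)
  assume no: "\<not> ?thesis"
  define D where "D = {C \<in> Pow {..<d}. odd (card (A \<inter> C)) \<noteq> odd (card (B \<inter> C))}"
  define E where "E = {C \<in> Pow {..<d}. odd (card (A \<inter> C)) = odd (card (B \<inter> C))}"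
  obtain x where x: "x \<in> A \<longleftrightarrow> x \<notin> B" using AB(3) by blast
  have "x < d" using x AB by blast
  define t where "t C = (if x \<in> C then C - {x} else insert x C)" for C
  have parity: "odd (card (F \<inter> t C)) \<longleftrightarrow> (odd (card (F \<inter> C)) \<noteq> (x \<in> F))"
    if "F \<subseteq> {..<d}" for F C
  proof -
    have fin: "finite (F \<inter> C)" using that finite_subset by blast
    show ?thesis
    proof (cases "x \<in> F")
      case False
      then have "F \<inter> t C = F \<inter> C" by (auto simp: t_def)
      then show ?thesis using False by simp
    next
      case True
      show ?thesis
      proof (cases "x \<in> C")
        case xC: True
        have "F \<inter> C = insert x (F \<inter> t C)" "x \<notin> F \<inter> t C" using True xC by (auto simp: t_def)
        moreover have "finite (F \<inter> t C)" using that finite_subset by blast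
        ultimately show ?thesis using True by simp
      next
        case xC: False
        have "F \<inter> t C = insert x (F \<inter> C)" "x \<notin> F \<inter> C" using True xC by (auto simp: t_def)
        then show ?thesis using True fin by simp
      qed
    qed
  qed
  have tt: "t (t C) = C" for C by (auto simp: t_def)
  have sub: "t C \<subseteq> {..<d}" if "C \<subseteq> {..<d}" for C using that \<open>x < d\<close> by (auto simp: t_def)
  have "bij_betw t D E"
  proof (rule bij_betw_byWitness[where f' = t])
    have "t C \<in> E" if "C \<in> D" for C
      using that sub[of C] parity[OF AB(1), of C] parity[OF AB(2), of C] x
      unfolding D_def E_def mem_Collect_eq Pow_iff by argo
    then show "t ` D \<subseteq> E" by blast
    have "t C \<in> D" if "C \<in> E" for C
      using that sub[of C] parity[OF AB(1), of C] parity[OF AB(2), of C] x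
      unfolding D_def E_def mem_Collect_eq Pow_iff by argo
    then show "t ` E \<subseteq> D" by blast
  qed (simp_all add: tt)
  then have "card D = card E" by (rule bij_betw_same_card)
  moreover have "D \<union> E = Pow {..<d}" "D \<inter> E = {}" by (auto simp: D_def E_def)
  moreover have fin: "finite D" "finite E" by (auto simp: D_def E_def)
  ultimately have "2 * card E = 2 ^ d"
    using card_Un_disjoint[of D E] by (simp add: card_Pow)
  \<comment> \<open>\<open>E\<close> contains the empty set, which is not a label, so fewer than
    \<open>2 ^ (d - 1)\<close> labels fail to tell \<open>A\<close> and \<open>B\<close>
    apart.\<close>
  moreover have "Y \<subseteq> E - {{}}" using no Y(1) by (auto simp: E_def)
  then have "card Y \<le> card (E - {{}})" using fin by (intro card_mono) auto
  moreover have "card (E - {{}}) < card E" using fin by (intro card_Diff1_less) (auto simp: E_def)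
  moreover have "(2 :: nat) ^ d = 2 * 2 ^ (d - 1)" using d by (simp add: power_eq_if)
  ultimately show False using Y(2) by simp
qed

section \<open>The grid of cliques\<close>

text \<open>Vertices are known only through a bijection with pairs of a cell and a label, so that
  all concrete copies are instances.\<close>

locale cell_graph =
  fixes N q d :: nat and V :: "'v set" and cell :: "'v \<Rightarrow> nat \<times> nat" and label :: "'v \<Rightarrow> nat set"
  assumes N: "1 < N" and q: "1 < q" and d: "0 < d"
    and bij: "bij_betw (\<lambda>v. (cell v, label v)) V (({..<N} \<times> {..<q}) \<times> nonempty_subsets d)"
begin

definition adj :: "'v \<Rightarrow> 'v \<Rightarrow> bool" where
  "adj u v \<longleftrightarrow> u \<noteq> v \<and> (cell u = cell v \<or>
     grid_adjacent (cell u) (cell v) \<and> odd (card (label u \<inter> label v)))"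

definition G :: "'v ugraph" where
  "G = \<lparr>verts = V, edges = {{u, v} | u v. u \<in> V \<and> v \<in> V \<and> adj u v}\<rparr>"

definition clique :: "nat \<times> nat \<Rightarrow> 'v set" where
  "clique g = {v \<in> V. cell v = g}"

lemma verts_G [simp]: "verts G = V"
  by (simp add: G_def)

lemma adj_sym: "adj u v \<longleftrightarrow> adj v u"
  by (auto simp: adj_def grid_adjacent_sym Int_commute)

lemma edge_iff: "{u, v} \<in> edges G \<longleftrightarrow> u \<in> V \<and> v \<in> V \<and> adj u v"
  by (auto simp: G_def doubleton_eq_iff adj_sym)

lemma edgeE:
  assumes "e \<in> edges G"
  obtains u v where "e = {u, v}" "u \<in> V" "v \<in> V" "adj u v"
  using assms by (auto simp: G_def)

lemma finite_V [simp]: "finite V"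
  using bij_betw_finite[OF bij] by simp

lemma card_V: "card V = N * q * (2 ^ d - 1)"
  using bij_betw_same_card[OF bij] by (simp add: card_nonempty_subsets card_cartesian_product)

lemma simple_G: "simple_graph G"
  unfolding simple_graph_def
proof (intro conjI ballI)
  fix e assume "e \<in> edges G"
  then obtain u v where "e = {u, v}" "u \<in> V" "v \<in> V" "adj u v" by (rule edgeE)
  then show "e \<subseteq> verts G" "card e = 2" by (auto simp: adj_def)
qed simp

lemma cell_in: "v \<in> V \<Longrightarrow> cell v \<in> {..<N} \<times> {..<q}"
  and label_in: "v \<in> V \<Longrightarrow> label v \<in> nonempty_subsets d"
  using bij unfolding bij_betw_def by blast+

lemma inj_label: "inj_on label (clique g)"
  using bij by (auto simp: bij_betw_def inj_on_def clique_def)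

lemma label_image: "g \<in> {..<N} \<times> {..<q} \<Longrightarrow> label ` clique g = nonempty_subsets d"
proof (intro equalityI subsetI)
  fix B assume "g \<in> {..<N} \<times> {..<q}" "B \<in> nonempty_subsets d"
  then have "(g, B) \<in> (\<lambda>v. (cell v, label v)) ` V" using bij unfolding bij_betw_def by blast
  then show "B \<in> label ` clique g" by (auto simp: clique_def)
qed (use label_in in \<open>auto simp: clique_def\<close>)

lemma card_clique: "g \<in> {..<N} \<times> {..<q} \<Longrightarrow> card (clique g) = 2 ^ d - 1"
  by (metis label_image card_image inj_label card_nonempty_subsets)

lemma two_power_d: "(2 :: nat) ^ d = 2 * 2 ^ (d - 1)"
  using d by (simp add: power_eq_if)

text \<open>Transfers \<open>parity_distinguishes\<close> from labels to vertices. For adjacent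
  cells, \<open>B = {}\<close> yields a neighbour of a given vertex, and two labels yield a vertex
  adjacent to exactly one of their bearers.\<close>

lemma distinguishing_vertex:
  assumes "A \<subseteq> {..<d}" "B \<subseteq> {..<d}" "A \<noteq> B" and W: "W \<subseteq> clique h" "2 ^ (d - 1) \<le> card W"
  shows "\<exists>w \<in> W. odd (card (A \<inter> label w)) \<noteq> odd (card (B \<inter> label w))"
proof -
  have "card (label ` W) = card W" using inj_on_subset[OF inj_label W(1)] by (rule card_image)
  moreover have "label ` W \<subseteq> nonempty_subsets d" using W(1) label_in unfolding clique_def by blast
  ultimately show ?thesis
    using parity_distinguishes[OF assms(1-3) d, of "label ` W"] W(2) by simp
qed

lemma no_isolated_G: "no_isolated G"
  unfolding no_isolated_def
proof
  fix v assume "v \<in> verts G"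
  then have v: "v \<in> V" by simp
  obtain c r where cr: "cell v = (c, r)" "c < N" "r < q" using cell_in[OF v] by auto
  define h where "h = (c, if r = 0 then 1 else r - 1)"
  have h: "h \<in> {..<N} \<times> {..<q}" "grid_adjacent (cell v) h"
    using cr q by (auto simp: h_def grid_adjacent_def)
  have "(2 :: nat) ^ (d - 1) \<le> card (clique h)"
    using card_clique[OF h(1)] two_power_d one_le_power[of "2 :: nat" "d - 1"] by simp
  then obtain w where w: "w \<in> clique h" "odd (card (label v \<inter> label w))"
    using distinguishing_vertex[of "label v" "{}" "clique h" h] label_in[OF v] by auto
  then have "adj v w" "w \<in> V" using h(2) by (auto simp: adj_def clique_def)
  then have "{v, w} \<in> edges G" using v edge_iff by blast
  then show "\<exists>e \<in> edges G. v \<in> e" by blast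
qed

lemma edges_nonempty: "edges G \<noteq> {}"
proof -
  have "V \<noteq> {}"
  proof
    assume "V = {}"
    then have "N * q * (2 ^ d - 1) = 0" using card_V by simp
    moreover have "(2 :: nat) ^ d > 1" by (rule one_less_power) (use d in auto)
    ultimately show False using N q by simp
  qed
  then show ?thesis using no_isolated_G by (auto simp: no_isolated_def)
qed

section \<open>Balanced cuts and the lower bounds\<close>

text \<open>Let \<open>S i\<close> be the cells with at least \<open>2 ^ (d - 1)\<close> listed
  vertices after \<open>i\<close> steps. Listing a vertex affects only its own cell, so
  \<open>S\<close> gains at most one cell per step and \<open>filling_crossings\<close>
  applies.\<close>

lemma balanced_cut:
  assumes \<pi>: "\<pi> \<in> permutations_of_set V" and k: "2 * k < N" "2 * k < q"
  obtains j P where "j \<le> length \<pi>" "finite P" "k \<le> card P" "separated P"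
    "\<And>p. p \<in> P \<Longrightarrow> grid_adjacent (fst p) (snd p) \<and>
       2 ^ (d - 1) \<le> card (clique (fst p) \<inter> set (take j \<pi>)) \<and>
       2 ^ (d - 1) \<le> card (clique (snd p) - set (take j \<pi>))"
proof -
  define S where "S i = {g \<in> {..<N} \<times> {..<q}. 2 ^ (d - 1) \<le> card (clique g \<inter> set (take i \<pi>))}" for i
  have set: "set \<pi> = V" using \<pi> by (simp add: permutations_of_setD)
  have "S 0 = {}" by (simp add: S_def)
  moreover have "{..<N} \<times> {..<q} \<subseteq> S (length \<pi>)"
  proof
    fix g assume g: "g \<in> {..<N} \<times> {..<q}"
    have "clique g \<inter> set \<pi> = clique g" using set by (auto simp: clique_def)
    then show "g \<in> S (length \<pi>)"
      using g card_clique[OF g] two_power_d one_le_power[of "2 :: nat" "d - 1"] by (simp add: S_def)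
  qed
  moreover have "\<exists>x. S (Suc i) \<subseteq> insert x (S i)" if "i < length \<pi>" for i
  proof (intro exI subsetI)
    fix g assume g: "g \<in> S (Suc i)"
    show "g \<in> insert (cell (\<pi> ! i)) (S i)"
    proof (cases "g = cell (\<pi> ! i)")
      case False
      then have "clique g \<inter> set (take (Suc i) \<pi>) = clique g \<inter> set (take i \<pi>)"
        using that by (auto simp: take_Suc_conv_app_nth clique_def)
      then show ?thesis using g by (simp add: S_def)
    qed simp
  qed
  ultimately obtain j P where jP: "j \<le> length \<pi>" "finite P" "k \<le> card P" "separated P"
    "\<forall>(g, h) \<in> P. grid_adjacent g h \<and> g \<in> {..<N} \<times> {..<q} \<and> h \<in> {..<N} \<times> {..<q} \<and> g \<in> S j \<and> h \<notin> S j"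
    using filling_crossings[OF k, of S "length \<pi>"] by blast
  show ?thesis
  proof (rule that[OF jP(1-4)])
    fix p assume "p \<in> P"
    then have p: "grid_adjacent (fst p) (snd p)" "fst p \<in> S j" "snd p \<in> {..<N} \<times> {..<q}" "snd p \<notin> S j"
      using jP(5) by (auto simp: split_beta)
    have "card (clique (snd p)) = card (clique (snd p) \<inter> set (take j \<pi>)) + card (clique (snd p) - set (take j \<pi>))"
      by (rule card_Int_Diff) (simp add: clique_def)
    moreover have "card (clique (snd p) \<inter> set (take j \<pi>)) < 2 ^ (d - 1)" using p by (simp add: S_def)
    \<comment> \<open>A clique has \<open>2 * 2 ^ (d - 1) - 1\<close> vertices, so fewer than
      \<open>2 ^ (d - 1)\<close> listed ones leave at least \<open>2 ^ (d - 1)\<close>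
      unlisted.\<close>
    ultimately have "2 ^ (d - 1) \<le> card (clique (snd p) - set (take j \<pi>))"
      using card_clique[OF p(3)] two_power_d by linarith
    then show "grid_adjacent (fst p) (snd p) \<and>
       2 ^ (d - 1) \<le> card (clique (fst p) \<inter> set (take j \<pi>)) \<and>
       2 ^ (d - 1) \<le> card (clique (snd p) - set (take j \<pi>))"
      using p by (simp add: S_def)
  qed
qed

lemma finite_edges: "finite (edges G)"
  using simple_G unfolding simple_graph_def by (meson Pow_iff finite_Pow_iff finite_subset subsetI)

lemma finite_induced_matchings: "finite {M. induced_matching (upper_subgraph G U) A B M}"
  by (rule finite_subset[of _ "Pow (edges G)"])
    (auto simp: induced_matching_def upper_subgraph_def finite_edges)

text \<open>At the balanced cut every separated pair contributes one edge from a listed to an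
  unlisted vertex, and separation makes these edges an induced matching of the upper
  subgraph.\<close>

lemma lu_width_ge:
  assumes \<pi>: "\<pi> \<in> permutations_of_set V" and k: "2 * k < N" "2 * k < q"
  shows "k \<le> lu_width_of G \<pi>"
proof -
  obtain j P where j: "j \<le> length \<pi>" and P: "finite P" "k \<le> card P" "separated P" and
    bal: "\<And>p. p \<in> P \<Longrightarrow> grid_adjacent (fst p) (snd p) \<and>
       2 ^ (d - 1) \<le> card (clique (fst p) \<inter> set (take j \<pi>)) \<and>
       2 ^ (d - 1) \<le> card (clique (snd p) - set (take j \<pi>))"
    by (fact balanced_cut[OF assms])
  define U where "U = set (take j \<pi>)"
  have UV: "U \<subseteq> V" using \<pi> set_take_subset[of j \<pi>] by (simp add: U_def permutations_of_setD)
  have "\<forall>p \<in> P. \<exists>a b. a \<in> clique (fst p) \<inter> U \<and> b \<in> clique (snd p) - U \<and> odd (card (label a \<inter> label b))"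
  proof
    fix p assume p: "p \<in> P"
    have "clique (fst p) \<inter> U \<noteq> {}" using bal[OF p] by (auto simp: U_def)
    then obtain a where a: "a \<in> clique (fst p) \<inter> U" by blast
    have "label a \<in> nonempty_subsets d" using a label_in by (simp add: clique_def)
    then show "\<exists>a b. a \<in> clique (fst p) \<inter> U \<and> b \<in> clique (snd p) - U \<and> odd (card (label a \<inter> label b))"
      using distinguishing_vertex[of "label a" "{}" "clique (snd p) - U" "snd p"] bal[OF p] a
      by (auto simp: U_def)
  qed
  then obtain a b where ab: "\<And>p. p \<in> P \<Longrightarrow> a p \<in> clique (fst p) \<and> a p \<in> U \<and> b p \<in> clique (snd p) \<and> b p \<notin> U \<and>
      odd (card (label (a p) \<inter> label (b p)))" by (metis Diff_iff Int_iff)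
  have V: "a p \<in> V" "b p \<in> V" "cell (a p) = fst p" "cell (b p) = snd p" if "p \<in> P" for p
    using ab[OF that] by (auto simp: clique_def)
  have edge: "{a p, b p} \<in> edges G" if "p \<in> P" for p
    using V[OF that] ab[OF that] bal[OF that] by (auto simp: edge_iff adj_def)
  have inj: "a p \<noteq> a p'" "b p \<noteq> b p'" "\<not> adj (a p) (a p')" "\<not> adj (a p) (b p')"
    if "p \<in> P" "p' \<in> P" "p \<noteq> p'" for p p'
    using separatedD[OF P(3) that] V[OF that(1)] V[OF that(2)] unfolding adj_def by metis+
  have ne: "a p \<noteq> b p'" if "p \<in> P" "p' \<in> P" for p p' using ab that by metis
  define M where "M = (\<lambda>p. {a p, b p}) ` P"
  have "card M = card P" unfolding M_def
    by (rule card_image) (auto simp: inj_on_def doubleton_eq_iff dest: inj ne)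
  have "induced_matching (upper_subgraph G U) U (V - U) M"
    unfolding induced_matching_def
  proof (intro conjI)
    show sub: "M \<subseteq> edges (upper_subgraph G U)"
      using edge ab by (auto simp: M_def upper_subgraph_def)
    show "\<forall>e \<in> M. \<forall>e' \<in> M. e \<noteq> e' \<longrightarrow> e \<inter> e' = {}"
    proof (intro ballI impI)
      fix e e' assume "e \<in> M" "e' \<in> M" "e \<noteq> e'"
      then obtain p p' where p: "p \<in> P" "p' \<in> P" "e = {a p, b p}" "e' = {a p', b p'}"
        unfolding M_def by (elim imageE)
      have "p \<noteq> p'" using p(3,4) \<open>e \<noteq> e'\<close> by blast
      then show "e \<inter> e' = {}" using inj[OF p(1,2)] ne[OF p(1,2)] ne[OF p(2,1)] p(3,4) by auto
    qed
    show "\<forall>e \<in> M. \<exists>a \<in> U. \<exists>b \<in> V - U. e = {a, b}"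
      using ab V unfolding M_def by blast
    show "{e \<in> edges (upper_subgraph G U). e \<subseteq> \<Union> M} = M"
    proof (intro equalityI subsetI)
      fix e assume "e \<in> {e \<in> edges (upper_subgraph G U). e \<subseteq> \<Union> M}"
      then have e: "e \<in> edges G" "e \<inter> U \<noteq> {}" "e \<subseteq> \<Union> M" by (auto simp: upper_subgraph_def)
      \<comment> \<open>An edge of the upper subgraph has an end \<open>x\<close> in
        \<open>U\<close>, which must be some \<open>a p\<close> because every \<open>b p\<close>
        lies outside. Separation then forces the other end to be \<open>b p\<close>.\<close>
      obtain x y where xy: "e = {x, y}" "adj x y" "x \<in> U"
      proof -
        obtain u v where uv: "e = {u, v}" "adj u v" using e(1) by (rule edgeE)
        then consider "u \<in> U" | "v \<in> U" using e(2) by blast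
        then show ?thesis using that[of u v] that[of v u] uv adj_sym by (metis insert_commute)
      qed
      obtain p where p: "p \<in> P" "x = a p" using e(3) xy ab by (auto simp: M_def)
      obtain p' where p': "p' \<in> P" "y = a p' \<or> y = b p'" using e(3) xy by (auto simp: M_def)
      have "p' = p" using inj(3,4)[OF p(1) p'(1)] xy(2) p p' by blast
      then have "y = b p" using p' p xy(2) by (auto simp: adj_def)
      then show "e \<in> M" using p xy by (auto simp: M_def)
    qed (use sub in auto)
  qed
  then have "card P \<le> max_induced_matching (upper_subgraph G U) U (V - U)"
    unfolding max_induced_matching_def \<open>card M = card P\<close>[symmetric]
    by (intro Max_ge finite_imageI finite_induced_matchings imageI) simp
  also have "\<dots> \<le> lu_width_of G \<pi>"
    unfolding lu_width_of_def Let_def using j by (intro Max_ge) (auto simp: U_def)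
  finally show ?thesis using P(2) by simp
qed

lemma finite_perms: "finite (permutations_of_set V)" "permutations_of_set V \<noteq> {}"
  by (simp_all add: permutations_of_set_empty_iff)

lemma lu_ge:
  assumes "2 * k < N" "2 * k < q"
  shows "k \<le> lu G"
  unfolding lu_def using finite_perms lu_width_ge[OF _ assms] by simp

text \<open>Choose one false vertex among the listed ones in the first cell of each pair, all other
  listed vertices being true. Different choices leave different subfunctions, so there are at least
  as many nodes as choices.\<close>

lemma obdd_nodes_ge:
  assumes k: "2 * k < N" "2 * k < q" and rep: "represents B (graph_cnf G)"
  shows "(2 ^ (d - 1)) ^ k \<le> card (nodes B)"
proof -
  have obdd: "is_obdd V B" and acc: "\<And>P. accepts B (assignment V P) \<longleftrightarrow> vertex_cover G P"
    using rep by (simp_all add: represents_graph_cnf[OF simple_G])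
  obtain \<pi> where \<pi>: "\<pi> \<in> permutations_of_set V" and
    sub: "\<And>i I (f :: _ \<Rightarrow> _). \<lbrakk>\<And>s. s \<in> I \<Longrightarrow> f s \<subseteq> set (take i \<pi>);
          \<And>s s'. s \<in> I \<Longrightarrow> s' \<in> I \<Longrightarrow> s \<noteq> s' \<Longrightarrow> \<exists>Q \<subseteq> set (drop i \<pi>).
            accepts B (assignment V (f s \<union> Q)) \<noteq> accepts B (assignment V (f s' \<union> Q))\<rbrakk>
          \<Longrightarrow> card (I :: ((nat \<times> nat) \<times> (nat \<times> nat) \<Rightarrow> 'v) set) \<le> card (nodes B)"
    by (fact obdd_subfunctions[OF obdd])
  obtain j P where "j \<le> length \<pi>" and P: "finite P" "k \<le> card P" "separated P" and
    bal: "\<And>p. p \<in> P \<Longrightarrow> grid_adjacent (fst p) (snd p) \<and>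
       2 ^ (d - 1) \<le> card (clique (fst p) \<inter> set (take j \<pi>)) \<and>
       2 ^ (d - 1) \<le> card (clique (snd p) - set (take j \<pi>))"
    by (fact balanced_cut[OF \<pi> k])
  define U where "U = set (take j \<pi>)"
  have "set \<pi> = V" "distinct \<pi>" using \<pi> by (simp_all add: permutations_of_setD)
  then have U: "U \<subseteq> V" "set (drop j \<pi>) = V - U"
    using set_take_subset[of j \<pi>] set_take_disj_set_drop_if_distinct[of \<pi> j j]
      set_append[of "take j \<pi>" "drop j \<pi>"] by (auto simp: U_def)
  define I where "I = (\<Pi>\<^sub>E p \<in> P. clique (fst p) \<inter> U)"
  \<comment> \<open>Making only \<open>b\<close> false in the suffix tests a single adjacency: the
    chosen vertices are pairwise non-adjacent, and by separation only \<open>s p\<close> can be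
    adjacent to \<open>b\<close>.\<close>
  have cover: "vertex_cover G ((U - s ` P) \<union> (V - U - {b})) \<longleftrightarrow> even (card (label (s p) \<inter> label b))"
    if s: "s \<in> I" and p: "p \<in> P" and b: "b \<in> clique (snd p) - U" for s p b
  proof -
    have sP: "s p \<in> V" "s p \<in> U" "cell (s p) = fst p" if "p \<in> P" for p
      using s that by (auto simp: I_def clique_def PiE_iff)
    have bV: "b \<in> V" "b \<notin> U" "cell b = snd p" using b by (auto simp: clique_def)
    \<comment> \<open>\<open>K\<close> collects the false vertices; the true ones form a vertex
      cover iff \<open>K\<close> is independent.\<close>
    define K where "K = insert b (s ` P)"
    have K: "x \<notin> (U - s ` P) \<union> (V - U - {b}) \<longleftrightarrow> x \<in> K" if "x \<in> V" for x
      using that sP bV by (auto simp: K_def)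
    have "vertex_cover G ((U - s ` P) \<union> (V - U - {b})) \<longleftrightarrow> (\<forall>x \<in> K. \<forall>y \<in> K. \<not> adj x y)"
    proof
      assume c: "vertex_cover G ((U - s ` P) \<union> (V - U - {b}))"
      show "\<forall>x \<in> K. \<forall>y \<in> K. \<not> adj x y"
      proof (intro ballI notI)
        fix x y assume xy: "x \<in> K" "y \<in> K" "adj x y"
        then have "x \<in> V" "y \<in> V" using sP bV by (auto simp: K_def)
        then have "{x, y} \<in> edges G" using xy edge_iff by blast
        then have "{x, y} \<inter> ((U - s ` P) \<union> (V - U - {b})) \<noteq> {}" using c unfolding vertex_cover_def by blast
        then show False using K xy \<open>x \<in> V\<close> \<open>y \<in> V\<close> by blast
      qed
    next
      assume n: "\<forall>x \<in> K. \<forall>y \<in> K. \<not> adj x y"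
      show "vertex_cover G ((U - s ` P) \<union> (V - U - {b}))"
        unfolding vertex_cover_def
      proof
        fix e assume "e \<in> edges G"
        then obtain x y where xy: "e = {x, y}" "x \<in> V" "y \<in> V" "adj x y" by (rule edgeE)
        then have "x \<notin> K \<or> y \<notin> K" using n by blast
        then have "x \<in> (U - s ` P) \<union> (V - U - {b}) \<or> y \<in> (U - s ` P) \<union> (V - U - {b})"
          using K[OF xy(2)] K[OF xy(3)] by argo
        then show "e \<inter> ((U - s ` P) \<union> (V - U - {b})) \<noteq> {}" using xy(1) by blast
      qed
    qed
    also have "\<dots> \<longleftrightarrow> \<not> adj (s p) b"
    proof -
      have 1: "\<not> adj (s p') (s p'')" if "p' \<in> P" "p'' \<in> P" for p' p''
        using separatedD[OF P(3) that] sP[OF that(1)] sP[OF that(2)] unfolding adj_def by metis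
      have 2: "\<not> adj (s p') b" if "p' \<in> P" "p' \<noteq> p" for p'
        using separatedD[OF P(3) that(1) p that(2)] sP[OF that(1)] bV unfolding adj_def by metis
      have 3: "\<not> adj b b" by (simp add: adj_def)
      show ?thesis using 1 2 3 p adj_sym unfolding K_def by blast
    qed
    also have "\<dots> \<longleftrightarrow> even (card (label (s p) \<inter> label b))"
    proof -
      have "fst p \<noteq> snd p" using bal[OF p] by auto
      then show ?thesis using sP[OF p] bV bal[OF p] by (auto simp: adj_def)
    qed
    finally show ?thesis .
  qed
  have "card I \<le> card (nodes B)"
  proof (rule sub[of I "\<lambda>s. U - s ` P" j])
    fix s s' assume s: "s \<in> I" "s' \<in> I" "s \<noteq> s'"
    then obtain p where p: "p \<in> P" "s p \<noteq> s' p" unfolding I_def by (metis PiE_ext)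
    have sp: "s p \<in> clique (fst p)" "s' p \<in> clique (fst p)" using s p by (auto simp: I_def PiE_iff)
    then have "label (s p) \<noteq> label (s' p)" using p(2) inj_onD[OF inj_label _ sp] by blast
    moreover have "label (s p) \<subseteq> {..<d}" "label (s' p) \<subseteq> {..<d}"
      using sp label_in by (auto simp: clique_def)
    ultimately obtain b where b: "b \<in> clique (snd p) - U"
      "odd (card (label (s p) \<inter> label b)) \<noteq> odd (card (label (s' p) \<inter> label b))"
      using distinguishing_vertex[of "label (s p)" "label (s' p)" "clique (snd p) - U" "snd p"] bal[OF p(1)]
      by (auto simp: U_def)
    show "\<exists>Q \<subseteq> set (drop j \<pi>). accepts B (assignment V (U - s ` P \<union> Q)) \<noteq>
        accepts B (assignment V (U - s' ` P \<union> Q))"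
      unfolding acc U(2) using cover[OF s(1) p(1) b(1)] cover[OF s(2) p(1) b(1)] b(2)
      by (intro exI[of _ "V - U - {b}"]) auto
  qed (auto simp: U_def)
  moreover have "(2 ^ (d - 1)) ^ k \<le> card I"
  proof -
    have "(2 ^ (d - 1)) ^ k \<le> ((2 :: nat) ^ (d - 1)) ^ card P" using P(2) by (intro power_increasing) auto
    also have "\<dots> = (\<Prod>p \<in> P. 2 ^ (d - 1))" by simp
    also have "\<dots> \<le> (\<Prod>p \<in> P. card (clique (fst p) \<inter> U))" using bal by (intro prod_mono) (auto simp: U_def)
    also have "\<dots> = card I" unfolding I_def using P(1) by (simp add: card_PiE)
    finally show ?thesis .
  qed
  ultimately show ?thesis by simp
qed

section \<open>The column order and the upper bounds\<close>

text \<open>Numbers the cells column by column, \<open>q\<close> cells to a column, so that adjacent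
  cells have numbers differing by \<open>1\<close> or \<open>q\<close>.\<close>

definition key :: "'v \<Rightarrow> nat" where
  "key v = fst (cell v) * q + snd (cell v)"

lemma key_cell:
  assumes "u \<in> V" "v \<in> V" "key u = key v"
  shows "cell u = cell v"
proof -
  have "snd (cell u) < q" "snd (cell v) < q" using cell_in assms by (auto simp: mem_Times_iff)
  then have "fst (cell u) = key u div q" "fst (cell v) = key v div q"
    "snd (cell u) = key u mod q" "snd (cell v) = key v mod q" by (simp_all add: key_def)
  then show ?thesis using assms(3) by (simp add: prod_eq_iff)
qed

lemma adj_key: "adj u v \<Longrightarrow> key v \<le> key u + q"
  using q by (auto simp: adj_def grid_adjacent_def key_def)

definition column_order :: "'v list" where
  "column_order = sort_key key (SOME xs. set xs = V \<and> distinct xs)"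

lemma column_order: "set column_order = V" "distinct column_order" "sorted (map key column_order)"
proof -
  have "set (SOME xs. set xs = V \<and> distinct xs) = V \<and> distinct (SOME xs. set xs = V \<and> distinct xs)"
    using finite_distinct_list[OF finite_V] by (rule someI_ex)
  then show "set column_order = V" "distinct column_order" "sorted (map key column_order)"
    by (simp_all add: column_order_def)
qed

lemma column_order_perm: "column_order \<in> permutations_of_set V"
  using column_order by (simp add: permutations_of_setI)

text \<open>Let \<kappa> be the least key of an unlisted vertex. Listed vertices have keys at most
  \<kappa> because the order is sorted. A frontier vertex has an unlisted neighbour, whose key is at
  least \<kappa> and exceeds its own by at most \<open>q\<close>. So at most \<open>q + 1\<close>
  keys occur.\<close>

lemma key_frontier:
  defines "U \<equiv> \<lambda>i. set (take i column_order)"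
  shows "\<exists>\<kappa>. key ` frontier G (U i) \<subseteq> {\<kappa> - q..\<kappa>}"
proof (cases "V - U i = {}")
  case True
  then show ?thesis by (auto simp: frontier_def)
next
  case False
  define \<kappa> where "\<kappa> = Min (key ` (V - U i))"
  have "key u \<le> key w" if "u \<in> U i" "w \<in> V - U i" for u w
  proof -
    have "sorted (map key (take i column_order) @ map key (drop i column_order))"
      using column_order(3) by (metis append_take_drop_id map_append)
    moreover have "w \<in> set (drop i column_order)"
      using that(2) column_order(1) set_append[of "take i column_order" "drop i column_order"]
      by (auto simp: U_def)
    ultimately show ?thesis using that(1) by (auto simp: sorted_append U_def)
  qed
  moreover have "\<kappa> \<in> key ` (V - U i)" unfolding \<kappa>_def using False by (intro Min_in) auto
  ultimately have "key u \<le> \<kappa>" if "u \<in> U i" for u using that by blast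
  moreover have "\<kappa> \<le> key u + q" if u: "u \<in> frontier G (U i)" for u
  proof -
    obtain w where w: "w \<in> V - U i" "{u, w} \<in> edges G" using u by (auto simp: frontier_def)
    then have "\<kappa> \<le> key w" unfolding \<kappa>_def by (intro Min_le) auto
    also have "\<dots> \<le> key u + q" using w edge_iff adj_key by blast
    finally show ?thesis .
  qed
  ultimately show ?thesis by (intro exI[of _ \<kappa>]) (fastforce simp: frontier_def)
qed

text \<open>
  The ends of an induced matching inside \<open>U\<close> lie in distinct cliques, since edges inside \<open>U\<close>
  are present in the upper subgraph.
\<close>
lemma lu_le: "lu G \<le> Suc q"
proof -
  have small: "card M \<le> Suc q"
    if M: "induced_matching (upper_subgraph G U) U (V - U) M" and U: "U = set (take i column_order)" for i U M
  proof -
    have sub: "M \<subseteq> edges (upper_subgraph G U)"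
      and disj: "\<And>e e'. e \<in> M \<Longrightarrow> e' \<in> M \<Longrightarrow> e \<noteq> e' \<Longrightarrow> e \<inter> e' = {}"
      and ind: "\<And>e. e \<in> edges (upper_subgraph G U) \<Longrightarrow> e \<subseteq> \<Union> M \<Longrightarrow> e \<in> M"
      using M by (auto simp: induced_matching_def)
    have "\<forall>e \<in> M. \<exists>a \<in> U. \<exists>b \<in> V - U. e = {a, b}" using M unfolding induced_matching_def by (elim conjE)
    then obtain a b where ab: "\<And>e. e \<in> M \<Longrightarrow> a e \<in> U \<and> b e \<in> V - U \<and> e = {a e, b e}" by metis
    have edge: "e \<in> edges G" if "e \<in> M" for e using sub that by (auto simp: upper_subgraph_def)
    have fr: "a e \<in> frontier G U" if "e \<in> M" for e
      using ab[OF that] edge[OF that] unfolding frontier_def by (auto intro!: bexI[of _ "b e"])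
    have UV: "U \<subseteq> V" unfolding U using column_order(1) by (metis set_take_subset)
    have "inj_on (key \<circ> a) M"
    proof (rule inj_onI, rule ccontr)
      fix e e' assume e: "e \<in> M" "e' \<in> M" "(key \<circ> a) e = (key \<circ> a) e'" "e \<noteq> e'"
      have aV: "a e \<in> V" "a e' \<in> V" "a e \<in> U" "a e' \<in> U" using ab e(1,2) UV by blast+
      have "a e \<in> e" "a e' \<in> e'" using ab[OF e(1)] ab[OF e(2)] by blast+
      then have ne: "a e \<noteq> a e'" using disj[OF e(1,2,4)] by auto
      have "cell (a e) = cell (a e')" using key_cell[OF aV(1,2)] e(3) by simp
      then have "{a e, a e'} \<in> edges G" using aV ne by (simp add: edge_iff adj_def)
      then have "{a e, a e'} \<in> edges (upper_subgraph G U)" using aV by (simp add: upper_subgraph_def)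
      moreover have "{a e, a e'} \<subseteq> \<Union> M" using \<open>a e \<in> e\<close> \<open>a e' \<in> e'\<close> e by blast
      ultimately have "{a e, a e'} \<in> M" by (rule ind)
      then show False using disj[of "{a e, a e'}" e] disj[of "{a e, a e'}" e'] e \<open>a e \<in> e\<close> \<open>a e' \<in> e'\<close>
        by blast
    qed
    then have "card M = card ((key \<circ> a) ` M)" by (rule card_image[symmetric])
    also obtain \<kappa> where \<kappa>: "key ` frontier G U \<subseteq> {\<kappa> - q..\<kappa>}" using key_frontier U by blast
    have "(key \<circ> a) ` M \<subseteq> {\<kappa> - q..\<kappa>}" using fr \<kappa> by auto
    then have "card ((key \<circ> a) ` M) \<le> card {\<kappa> - q..\<kappa>}" by (intro card_mono) auto
    finally show ?thesis by simp
  qed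
  \<comment> \<open>The empty matching shows that the maximum is taken over a nonempty set, as
    bounding it from above requires.\<close>
  have empty: "induced_matching (upper_subgraph G U) U (V - U) {}" for U
  proof -
    have "e \<noteq> {}" if "e \<in> edges G" for e using that by (elim edgeE) auto
    then show ?thesis by (auto simp: induced_matching_def upper_subgraph_def)
  qed
  have width: "max_induced_matching (upper_subgraph G U) U (V - U) \<le> Suc q"
    if U: "U = set (take i column_order)" for U i
    unfolding max_induced_matching_def
  proof (intro Max.boundedI)
    show "finite (card ` {M. induced_matching (upper_subgraph G U) U (V - U) M})"
      by (intro finite_imageI finite_induced_matchings)
    fix n assume "n \<in> card ` {M. induced_matching (upper_subgraph G U) U (V - U) M}"
    then show "n \<le> Suc q" using U small by blast
  qed (use empty in blast)
  have "lu_width_of G column_order \<le> Suc q"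
    unfolding lu_width_of_def Let_def using width by (subst Max_le_iff) auto
  moreover have "lu G \<le> lu_width_of G column_order"
    unfolding lu_def using column_order_perm finite_perms by (intro Min_le) auto
  ultimately show ?thesis by simp
qed

text \<open>With a single label each cell is one vertex, so keys are injective on the frontier and
  the window of \<open>key_frontier\<close> bounds its size.\<close>

lemma card_frontier_le:
  assumes "d = 1"
  shows "card (frontier G (set (take i column_order))) \<le> Suc q"
proof -
  let ?F = "frontier G (set (take i column_order))"
  obtain \<kappa> where \<kappa>: "key ` ?F \<subseteq> {\<kappa> - q..\<kappa>}" using key_frontier by blast
  have FV: "?F \<subseteq> V" using column_order(1) set_take_subset by (fastforce simp: frontier_def)
  have "inj_on key ?F"
  proof (rule inj_onI)
    fix u v assume uv: "u \<in> ?F" "v \<in> ?F" "key u = key v"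
    then have "u \<in> V" "v \<in> V" using FV by blast+
    have "cell u = cell v" using key_cell[OF \<open>u \<in> V\<close> \<open>v \<in> V\<close> uv(3)] .
    moreover have "nonempty_subsets d = {{0}}" using assms by (auto simp: lessThan_Suc)
    then have "label u = label v" using label_in[OF \<open>u \<in> V\<close>] label_in[OF \<open>v \<in> V\<close>] by simp
    ultimately show "u = v" using bij \<open>u \<in> V\<close> \<open>v \<in> V\<close> by (auto simp: bij_betw_def inj_on_def)
  qed
  then have "card ?F = card (key ` ?F)" by (simp add: card_image)
  also have "\<dots> \<le> card {\<kappa> - q..\<kappa>}" using \<kappa> by (intro card_mono) auto
  finally show ?thesis by simp
qed

end

section \<open>The three classes\<close>

text \<open>The number of vertices is invariant under isomorphism, so members with different counts
  lie in different classes.\<close>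

lemma infinite_up_to_isoI:
  assumes "infinite A" "inj_on (\<lambda>i. card (verts (f i))) A"
  shows "infinite_up_to_iso (f ` A)"
  unfolding infinite_up_to_iso_def
proof
  assume fin: "finite (f ` A // graph_iso)"
  have card_eq: "card (verts G) = card (verts H)" if "(G, H) \<in> graph_iso" for G H :: "'b ugraph"
    using that bij_betw_same_card by (auto simp: graph_iso_def)
  have refl: "(G, G) \<in> graph_iso" for G :: "'b ugraph"
    by (auto simp: graph_iso_def intro!: exI[of _ id])
  have "inj_on (\<lambda>i. graph_iso `` {f i}) A"
  proof (rule inj_onI)
    fix i j assume ij: "i \<in> A" "j \<in> A" "graph_iso `` {f i} = graph_iso `` {f j}"
    then have "(f i, f j) \<in> graph_iso" using refl by blast
    then show "i = j" using card_eq ij(1,2) assms(2) by (auto dest: inj_onD)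
  qed
  moreover have "(\<lambda>i. graph_iso `` {f i}) ` A \<subseteq> f ` A // graph_iso" by (auto simp: quotient_def)
  ultimately show False using fin assms(1) by (meson finite_imageD finite_subset)
qed

text \<open>The copy index \<open>k\<close> sits in the outermost pair, so that it can be read off
  any vertex.\<close>

definition vertex_code :: "nat \<Rightarrow> nat \<times> nat \<Rightarrow> nat set \<Rightarrow> nat" where
  "vertex_code k g B = prod_encode (k, prod_encode (prod_encode g, set_encode B))"

definition vertex_cell :: "nat \<Rightarrow> nat \<times> nat" where
  "vertex_cell v = prod_decode (fst (prod_decode (snd (prod_decode v))))"

definition vertex_label :: "nat \<Rightarrow> nat set" where
  "vertex_label v = set_decode (snd (prod_decode (snd (prod_decode v))))"

definition vertex_set :: "nat \<Rightarrow> nat \<Rightarrow> nat \<Rightarrow> nat \<Rightarrow> nat set" where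
  "vertex_set k N q d = (\<lambda>(g, B). vertex_code k g B) ` (({..<N} \<times> {..<q}) \<times> nonempty_subsets d)"

text \<open>The index \<open>k\<close> only provides infinitely many labelled copies of the same graph.\<close>
definition grid_graph :: "nat \<Rightarrow> nat \<Rightarrow> nat \<Rightarrow> nat \<Rightarrow> nat ugraph" where
  "grid_graph k N q d = cell_graph.G (vertex_set k N q d) vertex_cell vertex_label"

lemma vertex_code_simps [simp]:
  "vertex_cell (vertex_code k g B) = g"
  "finite B \<Longrightarrow> vertex_label (vertex_code k g B) = B"
  "fst (prod_decode (vertex_code k g B)) = k"
  by (simp_all add: vertex_cell_def vertex_label_def vertex_code_def)

lemma cell_graph_vertex_set:
  assumes "1 < N" "1 < q" "0 < d"
  shows "cell_graph N q d (vertex_set k N q d) vertex_cell vertex_label"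
proof
  have fin: "finite B" if "B \<subseteq> {..<d}" for B
    using that finite_subset by auto
  show "bij_betw (\<lambda>v. (vertex_cell v, vertex_label v)) (vertex_set k N q d)
      (({..<N} \<times> {..<q}) \<times> nonempty_subsets d)"
    by (rule bij_betw_byWitness[where f' = "\<lambda>(g, B). vertex_code k g B"])
      (use fin in \<open>auto simp: vertex_set_def\<close>)
qed (use assms in auto)

lemma grid_graph:
  assumes "1 < N" "1 < q" "0 < d"
  shows "verts (grid_graph k N q d) = vertex_set k N q d"
    and "simple_graph (grid_graph k N q d)" and "no_isolated (grid_graph k N q d)"
    and "card (verts (grid_graph k N q d)) = N * q * (2 ^ d - 1)"
    and "lu (grid_graph k N q d) \<le> Suc q"
    and "2 * r < N \<Longrightarrow> 2 * r < q \<Longrightarrow> r \<le> lu (grid_graph k N q d)"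
    and "2 * r < N \<Longrightarrow> 2 * r < q \<Longrightarrow> (2 ^ (d - 1)) ^ r \<le> obdd (graph_cnf (grid_graph k N q d))"
    and "d = 1 \<Longrightarrow> obdd (graph_cnf (grid_graph k N q d)) \<le> 2 + N * q * 2 ^ Suc q"
proof -
  interpret cell_graph N q d "vertex_set k N q d" vertex_cell vertex_label
    by (rule cell_graph_vertex_set) fact+
  show "verts (grid_graph k N q d) = vertex_set k N q d"
    "simple_graph (grid_graph k N q d)" "no_isolated (grid_graph k N q d)"
    "card (verts (grid_graph k N q d)) = N * q * (2 ^ d - 1)"
    "lu (grid_graph k N q d) \<le> Suc q"
    "2 * r < N \<Longrightarrow> 2 * r < q \<Longrightarrow> r \<le> lu (grid_graph k N q d)"
    unfolding grid_graph_def using simple_G no_isolated_G card_V lu_le lu_ge by auto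
  show "(2 ^ (d - 1)) ^ r \<le> obdd (graph_cnf (grid_graph k N q d))" if "2 * r < N" "2 * r < q"
    unfolding grid_graph_def using obdd_attained[OF simple_G edges_nonempty] obdd_nodes_ge[OF that] by metis
  show "obdd (graph_cnf (grid_graph k N q d)) \<le> 2 + N * q * 2 ^ Suc q" if "d = 1"
  proof -
    have "obdd (graph_cnf G) \<le> 2 + card (verts G) * 2 ^ Suc q"
      by (rule obdd_graph_cnf_le[OF simple_G edges_nonempty, of column_order])
        (use column_order_perm card_frontier_le[OF that] in simp_all)
    moreover have "card (verts G) = N * q" using card_V \<open>d = 1\<close> unfolding verts_G by simp
    ultimately show ?thesis unfolding grid_graph_def by simp
  qed
qed

text \<open>An OBDD has a node for every variable on which its function depends, so a bound in
  \<open>r\<close> alone also bounds the number of vertices of a graph without isolated vertices.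
  Hence \<open>\<G>1\<close> is infinite only as a set of labelled graphs, while
  \<open>\<G>1'\<close> is infinite up to isomorphism at the price of a factor linear in the number
  of vertices.\<close>

theorem theorem3:
  shows "\<exists>a b c d :: real. 0 < a \<and> 0 < b \<and> 0 < c \<and> 0 < d \<and>
    (\<forall>r :: nat. r \<ge> 1 \<longrightarrow>
      (\<exists>\<G>1 \<G>1' \<G>2 :: nat ugraph set.
         infinite \<G>1 \<and> infinite_up_to_iso \<G>1' \<and> infinite_up_to_iso \<G>2 \<and>
         (\<forall>G \<in> \<G>1 \<union> \<G>1' \<union> \<G>2. simple_graph G \<and> no_isolated G \<and>
            a * real r \<le> real (lu G) \<and> real (lu G) \<le> b * real r) \<and>
         (\<forall>G \<in> \<G>1. real (obdd (graph_cnf G)) \<le> 2 powr (c * real r)) \<and>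
         (\<forall>G \<in> \<G>1'. real (obdd (graph_cnf G)) \<le> 2 powr (c * real r) * real (card (verts G))) \<and>
         (\<forall>G \<in> \<G>2. real (obdd (graph_cnf G)) \<ge> real (card (verts G)) powr (d * real r))))"
proof (intro exI conjI allI impI)
  fix r :: nat assume r: "r \<ge> 1"
  \<comment> \<open>The smallest \<open>q\<close> with \<open>2 * r < q\<close>, as the lower bounds
    demand. The lu-mim width then lies between \<open>r\<close> and \<open>2 * r + 2\<close>, which
    is at most \<open>4 * r\<close>.\<close>
  define q where "q = 2 * r + 1"
  define \<G>1 where "\<G>1 = range (\<lambda>k. grid_graph k q q 1)"
  define \<G>1' where "\<G>1' = (\<lambda>N. grid_graph 0 N q 1) ` {q..}"
  \<comment> \<open>The range of \<open>d\<close> ensures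
    \<open>2 * q ^ 2 \<le> 2 ^ (d - 1)\<close>. The vertex count is then at most the square of
    \<open>2 ^ (d - 1)\<close>, which is where the exponent \<open>r / 2\<close> comes from.\<close>
  define \<G>2 where "\<G>2 = grid_graph 0 q q ` {2 * q\<^sup>2 + 1..}"
  have q: "1 < q" "2 * r < q" using r by (simp_all add: q_def)
  note gg = grid_graph[OF less_le_trans[OF q(1)] q(1)]
  have small: "obdd (graph_cnf (grid_graph k N q 1)) \<le> 2 ^ (5 * r) * (N * q)" if "q \<le> N" for k N
  proof -
    have "obdd (graph_cnf (grid_graph k N q 1)) \<le> 2 + N * q * 2 ^ Suc q"
      using gg(8)[OF that] by simp
    also have "\<dots> \<le> 2 ^ (2 * r + 3) * (N * q)"
    proof -
      have "1 \<le> N * q" "(2 :: nat) \<le> 2 ^ Suc q" using q(1) that by simp_all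
      then have "1 * 2 \<le> N * q * 2 ^ Suc q" by (rule mult_le_mono)
      moreover have "2 ^ (2 * r + 3) * (N * q) = N * q * 2 ^ Suc q + N * q * 2 ^ Suc q"
        by (simp add: q_def power_add)
      ultimately show ?thesis by linarith
    qed
    \<comment> \<open>\<open>2 * r + 3 \<le> 5 * r\<close> because \<open>r \<ge> 1\<close>.\<close>
    also have "\<dots> \<le> 2 ^ (5 * r) * (N * q)" using r by (intro mult_right_mono power_increasing) auto
    finally show ?thesis .
  qed
  have "inj (\<lambda>k. grid_graph k q q 1)"
  proof (rule injI)
    fix k l assume "grid_graph k q q 1 = grid_graph l q q 1"
    then have eq: "vertex_set k q q 1 = vertex_set l q q 1" using gg(1)[of q 1] by simp metis
    have "vertex_code k (0, 0) {0} \<in> vertex_set k q q 1"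
      using q(1) by (auto simp: vertex_set_def intro!: image_eqI[of _ _ "((0, 0), {0})"])
    then have "vertex_code k (0, 0) {0} \<in> vertex_set l q q 1" using eq by simp
    then obtain g B where "vertex_code k (0, 0) {0} = vertex_code l g B" by (auto simp: vertex_set_def)
    then show "k = l" by (metis vertex_code_simps(3))
  qed
  then show "infinite \<G>1" unfolding \<G>1_def using finite_imageD infinite_UNIV_nat by blast
  show "infinite_up_to_iso \<G>1'" unfolding \<G>1'_def
    by (rule infinite_up_to_isoI) (use q gg(4) in \<open>auto simp: infinite_Ici inj_on_def\<close>)
  show "infinite_up_to_iso \<G>2" unfolding \<G>2_def
  proof (rule infinite_up_to_isoI)
    show "inj_on (\<lambda>d. card (verts (grid_graph 0 q q d))) {2 * q\<^sup>2 + 1..}"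
    proof (rule inj_onI)
      fix d e assume de: "d \<in> {2 * q\<^sup>2 + 1..}" "e \<in> {2 * q\<^sup>2 + 1..}"
        "card (verts (grid_graph 0 q q d)) = card (verts (grid_graph 0 q q e))"
      then have "(2 :: nat) ^ d - 1 = 2 ^ e - 1" using q(1) gg(4)[of q d] gg(4)[of q e] by simp
      then have "(2 :: nat) ^ d = 2 ^ e"
        by (metis Suc_diff_1 zero_less_power pos2)
      then show "d = e" by simp
    qed
  qed (simp add: infinite_Ici)
  show "\<forall>G \<in> \<G>1 \<union> \<G>1' \<union> \<G>2. simple_graph G \<and> no_isolated G \<and>
      1 * real r \<le> real (lu G) \<and> real (lu G) \<le> 4 * real r"
  proof
    fix G assume "G \<in> \<G>1 \<union> \<G>1' \<union> \<G>2"
    then obtain k N d where G: "G = grid_graph k N q d" "q \<le> N" "0 < d"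
      by (auto simp: \<G>1_def \<G>1'_def \<G>2_def)
    have "r \<le> lu G" "lu G \<le> Suc q" "simple_graph G" "no_isolated G"
      using gg(2,3,5,6)[OF G(2,3)] q(2) G(1,2) by simp_all
    then show "simple_graph G \<and> no_isolated G \<and> 1 * real r \<le> real (lu G) \<and> real (lu G) \<le> 4 * real r"
      using r by (simp add: q_def)
  qed
  have powr: "2 powr (9 * real r) = 2 ^ (9 * r)" using powr_realpow[of 2 "9 * r"] by simp
  show "\<forall>G \<in> \<G>1. real (obdd (graph_cnf G)) \<le> 2 powr (9 * real r)"
  proof
    fix G assume "G \<in> \<G>1"
    then obtain k where G: "G = grid_graph k q q 1" by (auto simp: \<G>1_def)
    \<comment> \<open>For square grids the vertex count \<open>q * q\<close> is itself at most
      \<open>2 ^ (4 * r)\<close>, which raises the exponent from \<open>5 * r\<close> to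
      \<open>9 * r\<close>.\<close>
    have "q \<le> 2 ^ (2 * r)" using less_exp[of "2 * r"] unfolding q_def by linarith
    then have "q * q \<le> 2 ^ (2 * r) * 2 ^ (2 * r)" by (rule mult_le_mono) fact
    then have "2 ^ (5 * r) * (q * q) \<le> 2 ^ (5 * r) * (2 ^ (2 * r) * 2 ^ (2 * r))" by simp
    also have "\<dots> = 2 ^ (9 * r)" by (simp flip: power_add)
    finally have "obdd (graph_cnf G) \<le> 2 ^ (9 * r)" using small[of q k] G by simp
    then have "real (obdd (graph_cnf G)) \<le> real (2 ^ (9 * r))" by (rule of_nat_mono)
    then show "real (obdd (graph_cnf G)) \<le> 2 powr (9 * real r)" by (simp add: powr)
  qed
  show "\<forall>G \<in> \<G>1'. real (obdd (graph_cnf G)) \<le> 2 powr (9 * real r) * real (card (verts G))"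
  proof
    fix G assume "G \<in> \<G>1'"
    then obtain N where G: "G = grid_graph 0 N q 1" "q \<le> N" by (auto simp: \<G>1'_def)
    have card: "card (verts G) = N * q" using gg(4)[OF G(2), of 1] G(1) by simp
    have "obdd (graph_cnf G) \<le> 2 ^ (5 * r) * (N * q)" using small[OF G(2)] G(1) by simp
    also have "\<dots> \<le> 2 ^ (9 * r) * (N * q)" by (intro mult_right_mono power_increasing) auto
    finally have "real (obdd (graph_cnf G)) \<le> real (2 ^ (9 * r) * card (verts G))"
      unfolding card by (rule of_nat_mono)
    then show "real (obdd (graph_cnf G)) \<le> 2 powr (9 * real r) * real (card (verts G))"
      by (simp add: powr)
  qed
  show "\<forall>G \<in> \<G>2. real (obdd (graph_cnf G)) \<ge> real (card (verts G)) powr (1 / 2 * real r)"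
  proof
    fix G assume "G \<in> \<G>2"
    then obtain d where G: "G = grid_graph 0 q q d" "2 * q\<^sup>2 + 1 \<le> d" by (auto simp: \<G>2_def)
    define h :: nat where "h = 2 ^ (d - 1)"
    have "2 * q\<^sup>2 \<le> d - 1" using G(2) by simp
    also have "\<dots> \<le> h" unfolding h_def by (simp add: less_imp_le)
    finally have h: "2 * q\<^sup>2 \<le> h" .
    have "(2 :: nat) ^ d = 2 * h" using G(2) by (simp add: h_def power_eq_if)
    then have "card (verts G) = q * q * (2 * h - 1)" using gg(4)[of q d] G by simp
    also have "\<dots> \<le> q * q * (2 * h)" by (intro mult_left_mono) auto
    also have "\<dots> = 2 * q\<^sup>2 * h" by (simp add: power2_eq_square)
    also have "\<dots> \<le> h * h" using h by (rule mult_right_mono) simp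
    finally have "card (verts G) \<le> h * h" .
    then have card: "real (card (verts G)) \<le> real h * real h" by (metis of_nat_le_iff of_nat_mult)
    have "0 < h" by (simp add: h_def)
    have "real (card (verts G)) powr (1 / 2 * real r) \<le> (real h * real h) powr (1 / 2 * real r)"
      using card by (intro powr_mono2) auto
    also have "\<dots> = real h powr real r" using \<open>0 < h\<close> by (simp add: powr_mult flip: powr_add)
    also have "\<dots> = real (h ^ r)" using \<open>0 < h\<close> by (simp add: powr_realpow)
    also have "\<dots> \<le> real (obdd (graph_cnf G))"
      using gg(7)[of q d r 0] q(2) G by (intro of_nat_mono) (simp add: h_def)
    finally show "real (card (verts G)) powr (1 / 2 * real r) \<le> real (obdd (graph_cnf G))" .
  qed
qed simp_all

end
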